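(* Let $\Gamma=(V,E)$ be a strongly-connected weighted digraph and let $\mathcal{G}$ be its normalized Green's function. Then for all $u,v\in V$, $$\mathcal{G}(u,v)=\frac{\sqrt{\pi_u\pi_v}}{\tau_v}\Big(\sum_{\substack{T_1\cup T_2\in \mathbb{F}^*_2\\ u\in T_1,\ r(T_1)=v}}\pi(T_2)\,d_{r(T_2)}\,\omega(T_1\cup T_2)-\sum_{\substack{T_1\cup T_2\in \mathbb{F}^*_2\\ u\in T_2,\ r(T_1)=v}}\pi(T_1)\,d_{r(T_2)}\,\omega(T_1\cup T_2)\Big),$$ where $\pi(T):=\sum_{z\in T}\pi_z$ is the sum of the stationary distribution over the vertices of $T$.
   Context: A weighted digraph $\Gamma=(V,E)$ is finite with at least two vertices, has no loops, and has at most one edge $(u,v)$ for each ordered pair of distinct vertices; each edge $e=(u,v)\in E$ has a weight $\omega(e)=\omega(u,v)>0$, and $\omega(u,v)=0$ if $(u,v)\notin E$. The adjacency matrix is $A(u,v)=\omega(u,v)$, the (out-)degree is $d_u=\sum_v\omega(u,v)$, $D=\mathrm{Diag}[d_u]$, and $P=D^{-1}A$ is the transition probability matrix. For strongly-connected $\Gamma$, the stationary distribution $(\pi_u)_{u\in V}$ is the unique vector with $\pi_u>0$ for all $u$, $\sum_u\pi_u=1$ and $\pi^{T}P=\pi^{T}$; $\Pi=\mathrm{Diag}[\pi_u]$. The normalized Laplacian is $\mathcal{L}=\Pi^{1/2}(I-P)\Pi^{-1/2}$, and the normalized Green's function $\mathcal{G}$ is the Moore–Penrose pseudoinverse of $\mathcal{L}$;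 matrices are indexed by $V$. A rooted $k$-forest is a digraph whose underlying undirected graph is a forest with $k$ connected components (no cycles; in particular it does not contain both $(u,v)$ and $(v,u)$) and such that each weakly-connected component has a vertex, its root, to which every vertex of that component has a unique directed path. A subdigraph of $\Gamma$ is spanning if it contains all vertices of $\Gamma$. $\mathbb{F}^*_k$ denotes the set of spanning rooted $k$-forests of $\Gamma$. An element of $\mathbb{F}^*_2$ is written $T_1\cup T_2$, where $T_1,T_2$ are its two components, with roots $r(T_1),r(T_2)$. The order of $T_1$ and $T_2$ is irrelevant: a sum ranges over forests, each counted once, with the components named so that the condition under the sum holds (here $T_1$ is the component with root $v$). The weight of a forest is $\omega(F)=\prod_{e\in E(F)}\omega(e)$, and $\tau_w=\sum_{T\in\mathbb{F}^*_1,\ r(T)=w}\omega(T)$ is the total weight of the rooted spanning trees with root $w$. *)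

theory Defs
  imports "HOL-Analysis.Analysis" "Graph_Theory.Graph_Theory"
begin

section \<open>Matrices\<close>

definition diag_mat :: "('n \<Rightarrow> real) \<Rightarrow> real ^ 'n ^ 'n" where
  "diag_mat f = (\<chi> i j. if i = j then f i else 0)"

definition is_moore_penrose :: "real ^ 'n ^ 'm \<Rightarrow> real ^ 'm ^ 'n \<Rightarrow> bool" where
  "is_moore_penrose M X \<longleftrightarrow>
     M ** X ** M = M \<and> X ** M ** X = X \<and>
     transpose (M ** X) = M ** X \<and> transpose (X ** M) = X ** M"

definition moore_penrose :: "real ^ 'n ^ 'm \<Rightarrow> real ^ 'm ^ 'n" where
  "moore_penrose M = (THE X. is_moore_penrose M X)"


section \<open>Weighted digraphs and the normalized Green's function\<close>

text \<open>
  The vertex set is the whole (finite) vertex type, so that matrices indexed by the vertices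
  are elements of \<^typ>\<open>real ^ 'v ^ 'v\<close>. Finiteness and the absence of loops come from
  \<^locale>\<open>pair_digraph\<close>; parallel edges are impossible as edges are pairs.
\<close>

locale weighted_digraph = pair_digraph G
  for G :: "'v::finite pair_pre_digraph" +
  fixes \<omega> :: "('v \<times> 'v) weight_fun"
  assumes verts_UNIV: "pverts G = UNIV"
    and at_least_two_verts: "card (pverts G) \<ge> 2"
    and weight_pos: "e \<in> parcs G \<Longrightarrow> \<omega> e > 0"
    and weight_zero: "e \<notin> parcs G \<Longrightarrow> \<omega> e = 0"

definition adj_matrix :: "('v::finite \<times> 'v) weight_fun \<Rightarrow> real ^ 'v ^ 'v" where
  "adj_matrix \<omega> = (\<chi> u v. \<omega> (u, v))"

definition weighted_degree :: "('v::finite \<times> 'v) weight_fun \<Rightarrow> 'v \<Rightarrow> real" where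
  "weighted_degree \<omega> u = (\<Sum>v\<in>UNIV. \<omega> (u, v))"

definition transition_matrix :: "('v::finite \<times> 'v) weight_fun \<Rightarrow> real ^ 'v ^ 'v" where
  "transition_matrix \<omega> = matrix_inv (diag_mat (weighted_degree \<omega>)) ** adj_matrix \<omega>"

definition is_stationary :: "('v::finite \<times> 'v) weight_fun \<Rightarrow> real ^ 'v \<Rightarrow> bool" where
  "is_stationary \<omega> p \<longleftrightarrow>
     (\<forall>u. p $ u > 0) \<and> (\<Sum>u\<in>UNIV. p $ u) = 1 \<and> p v* transition_matrix \<omega> = p"

definition stationary :: "('v::finite \<times> 'v) weight_fun \<Rightarrow> real ^ 'v" where
  "stationary \<omega> = (THE p. is_stationary \<omega> p)"

definition sqrt_Pi :: "('v::finite \<times> 'v) weight_fun \<Rightarrow> real ^ 'v ^ 'v" where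
  "sqrt_Pi \<omega> = diag_mat (\<lambda>u. sqrt (stationary \<omega> $ u))"

definition normalized_laplacian :: "('v::finite \<times> 'v) weight_fun \<Rightarrow> real ^ 'v ^ 'v" where
  "normalized_laplacian \<omega> =
     sqrt_Pi \<omega> ** (mat 1 - transition_matrix \<omega>) ** matrix_inv (sqrt_Pi \<omega>)"

definition normalized_green :: "('v::finite \<times> 'v) weight_fun \<Rightarrow> real ^ 'v ^ 'v" where
  "normalized_green \<omega> = moore_penrose (normalized_laplacian \<omega>)"


section \<open>Rooted forests\<close>

text \<open>
  \<^const>\<open>mk_symmetric\<close> replaces every edge of the underlying undirected graph by a pair of
  opposite arcs, so each such edge yields a cycle of length 2 there. The cycles of the undirected
  graph are those of length at least 3; antiparallel edges in the digraph itself are excluded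
  by the first conjunct.
\<close>

definition underlying_forest :: "'a pair_pre_digraph \<Rightarrow> bool" where
  "underlying_forest H \<longleftrightarrow>
     (\<forall>u v. (u, v) \<in> parcs H \<longrightarrow> (v, u) \<notin> parcs H) \<and>
     \<not> (\<exists>p. pre_digraph.cycle (with_proj (mk_symmetric (with_proj H))) p \<and> length p \<ge> 3)"

definition weak_components :: "'a pair_pre_digraph \<Rightarrow> 'a pair_pre_digraph set" where
  "weak_components H =
     (\<lambda>S. \<lparr>pverts = S, parcs = parcs H \<inter> S \<times> S\<rparr>) `
       pre_digraph.sccs_verts (with_proj (mk_symmetric (with_proj H)))"

definition is_root :: "'a pair_pre_digraph \<Rightarrow> 'a \<Rightarrow> bool" where
  "is_root T r \<longleftrightarrow>
     r \<in> pverts T \<and> (\<forall>u\<in>pverts T. \<exists>!p. pre_digraph.apath (with_proj T) u p r)"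

definition root_of :: "'a pair_pre_digraph \<Rightarrow> 'a" where
  "root_of T = (THE r. is_root T r)"

definition rooted_forest :: "nat \<Rightarrow> 'a pair_pre_digraph \<Rightarrow> bool" where
  "rooted_forest k H \<longleftrightarrow>
     pair_digraph H \<and> underlying_forest H \<and> card (weak_components H) = k \<and>
     (\<forall>T\<in>weak_components H. \<exists>r. is_root T r)"

definition spanning_rooted_forests ::
    "'a pair_pre_digraph \<Rightarrow> nat \<Rightarrow> 'a pair_pre_digraph set" where
  "spanning_rooted_forests G k =
     {F. spanning (with_proj F) (with_proj G) \<and> rooted_forest k F}"

definition forest_weight :: "('a \<times> 'a) weight_fun \<Rightarrow> 'a pair_pre_digraph \<Rightarrow> real" where
  "forest_weight \<omega> F = (\<Prod>e\<in>parcs F. \<omega> e)"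

definition tree_weight :: "'a pair_pre_digraph \<Rightarrow> ('a \<times> 'a) weight_fun \<Rightarrow> 'a \<Rightarrow> real" where
  "tree_weight G \<omega> w =
     (\<Sum>T\<in>{T \<in> spanning_rooted_forests G 1. root_of T = w}. forest_weight \<omega> T)"

text \<open>
  A spanning rooted 2-forest together with a naming \<open>T1\<close>, \<open>T2\<close> of its two components. Both
  namings of each forest occur here; fixing the root of \<open>T1\<close> selects at most one of them.
\<close>

definition named_two_forests ::
    "'a pair_pre_digraph \<Rightarrow>
      ('a pair_pre_digraph \<times> 'a pair_pre_digraph \<times> 'a pair_pre_digraph) set" where
  "named_two_forests G =
     {(F, T1, T2). F \<in> spanning_rooted_forests G 2 \<and> weak_components F = {T1, T2}}"

definition stationary_mass ::
    "('v::finite \<times> 'v) weight_fun \<Rightarrow> 'v pair_pre_digraph \<Rightarrow> real" where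
  "stationary_mass \<omega> T = (\<Sum>z\<in>pverts T. stationary \<omega> $ z)"

end

theory Submission
  imports Defs
begin

text \<open>
  A spanning rooted forest is determined by its arc set, and the arc sets that occur are the
  relations that are single-valued and acyclic: every vertex has at most one out-arc, and the
  roots are the vertices without one. Such relations are called branchings below; \<open>branchings S\<close>
  are those with root set \<open>S\<close>. Giving a non-root \<open>u\<close> its out-arc turns a branching with root set
  \<open>insert u S\<close> into one with root set \<open>S\<close>, and every branching with root set \<open>S\<close> arises exactly once
  in this way (\<open>sum_branchings_insert\<close>). All the combinatorics rests on this single bijection.

  For \<open>r \<noteq> v\<close> let \<open>F x\<close> be the total weight of the 2-forests with roots \<open>r\<close> and \<open>v\<close> in which \<open>x\<close> lies
  in the tree of \<open>r\<close>. Cutting the out-arc of a vertex gives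
    \<open>((D - A) F) u = \<tau> v [u = r] - \<tau> r [u = v]\<close>
  (\<open>reach_total_laplacian\<close>). Two consequences are drawn from this identity.

  \<^item> Pairing it with a left null vector \<open>p\<close> of \<open>D - A\<close> gives \<open>p r \<tau> v = p v \<tau> r\<close>. A nonzero left null
    vector exists, since the rows of \<open>D - A\<close> sum to zero. So \<open>\<tau>\<close> spans the left null space, and the
    stationary distribution is \<open>\<pi> u = d u \<tau> u / K\<close> with \<open>K = \<Sum>u. d u \<tau> u\<close>.
  \<^item> Let \<open>g u v\<close> be the difference of the two forest sums in the theorem. As the masses of the two trees of a
    forest add up to 1, \<open>g u v\<close> equals a constant depending only on \<open>v\<close> minus the sum of \<open>d r F u\<close>
    over the roots \<open>r \<noteq> v\<close>. Constants are annihilated by \<open>D - A\<close>, hence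
    \<open>((D - A) g) (u, v) = K [u = v] - d u \<tau> v\<close> (\<open>green_sum_laplacian\<close>).

  With \<open>s u = sqrt (\<pi> u)\<close> and \<open>X (u, v) = s u s v g u v / \<tau> v\<close> the last identity says that the
  normalized Laplacian times \<open>X\<close> is the orthogonal projection \<open>I - s s\<^sup>T\<close>. Moreover \<open>s\<^sup>T X = 0\<close>, because
  in the sum of \<open>\<pi> u g u v\<close> over \<open>u\<close> every forest contributes the product of the masses of its two
  trees once with each sign. Since \<open>s\<close> is a left and right null vector of the normalized Laplacian,
  these two equations already make \<open>X\<close> its Moore--Penrose inverse (\<open>moore_penrose_corank_one\<close>).
\<close>

section \<open>Branchings as sets of arcs\<close>

definition branching :: "'v rel \<Rightarrow> bool" where
  "branching E \<longleftrightarrow> single_valued E \<and> acyclic E"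

definition branchings :: "'v set \<Rightarrow> 'v rel set" where
  "branchings S = {E. branching E \<and> Domain E = - S}"

text \<open>
  The height of a vertex is the number of vertices that a nonempty walk from it reaches. It drops
  along an arc: the tail reaches the head and all that the head reaches, but by acyclicity the head
  does not reach itself.
\<close>

lemma branching_height:
  fixes E :: "'v::finite rel"
  assumes "branching E"
  obtains h :: "'v \<Rightarrow> nat" where "\<And>x y. (x, y) \<in> E \<Longrightarrow> h y < h x"
proof -
  have "card (E\<^sup>+ `` {y}) < card (E\<^sup>+ `` {x})" if "(x, y) \<in> E" for x y
  proof (rule psubset_card_mono)
    have "(y, y) \<notin> E\<^sup>+" using assms by (auto simp: branching_def acyclic_def)
    then show "E\<^sup>+ `` {y} \<subset> E\<^sup>+ `` {x}" using that by (auto intro: trancl_into_trancl2)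
  qed simp
  then show thesis by (rule that)
qed

lemma branching_reaches_root:
  fixes E :: "'v::finite rel"
  assumes "branching E"
  shows "\<exists>s. (x, s) \<in> E\<^sup>* \<and> s \<notin> Domain E"
proof -
  obtain h :: "'v \<Rightarrow> nat" where h: "\<And>x y. (x, y) \<in> E \<Longrightarrow> h y < h x"
    using branching_height[OF assms] by blast
  show ?thesis
  proof (induction "h x" arbitrary: x rule: less_induct)
    case less
    show ?case
    proof (cases "x \<in> Domain E")
      case True
      then obtain y where "(x, y) \<in> E" by auto
      then show ?thesis using less[of y] h by (meson converse_rtrancl_into_rtrancl)
    qed auto
  qed
qed

text \<open>
  In a single-valued relation only one walk leaves \<open>x\<close>, so of two vertices on it one comes first.
  Applied to two roots, from which no arc leaves, this makes the root of a vertex unique.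
\<close>

lemma single_valued_reach_linear:
  assumes "single_valued E" "(x, y) \<in> E\<^sup>*" "(x, z) \<in> E\<^sup>*"
  shows "(y, z) \<in> E\<^sup>* \<or> (z, y) \<in> E\<^sup>*"
  using assms(2) assms(3)
proof (induction rule: rtrancl_induct)
  case (step y w)
  then show ?case
    using assms(1) by (metis converse_rtranclE rtrancl.rtrancl_into_rtrancl single_valuedD)
qed auto

lemma reach_from_root:
  assumes "s \<notin> Domain E" shows "(s, x) \<in> E\<^sup>* \<longleftrightarrow> x = s"
  using assms by (auto elim: converse_rtranclE)

lemma branching_root_unique:
  assumes "branching E" "(x, s) \<in> E\<^sup>*" "s \<notin> Domain E" "(x, t) \<in> E\<^sup>*" "t \<notin> Domain E"
  shows "s = t"
  using single_valued_reach_linear[of E x s t] assms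
  by (auto simp: branching_def reach_from_root)

lemma branchings_root:
  fixes E :: "'v::finite rel"
  assumes "E \<in> branchings S"
  shows "\<exists>!s. s \<in> S \<and> (x, s) \<in> E\<^sup>*"
proof -
  have E: "branching E" and S: "\<And>s. s \<in> S \<longleftrightarrow> s \<notin> Domain E"
    using assms by (auto simp: branchings_def)
  show ?thesis
    using branching_reaches_root[OF E, of x] branching_root_unique[OF E, of x] S by blast
qed

lemma branchings_reach_root:
  assumes "E \<in> branchings S" "s \<in> S" shows "(s, x) \<in> E\<^sup>* \<longleftrightarrow> x = s"
  using assms by (intro reach_from_root) (auto simp: branchings_def)

text \<open>
  The condition on \<open>y\<close> says that the new arc does not close a cycle.
\<close>

lemma insert_branchings:
  assumes g: "g \<in> branchings (insert u S)" and u: "u \<notin> S" and y: "(y, u) \<notin> g\<^sup>*"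
  shows "insert (u, y) g \<in> branchings S"
proof -
  have "u \<notin> Domain g" using g by (auto simp: branchings_def)
  moreover have "Domain (insert (u, y) g) = - S" using g u by (auto simp: branchings_def)
  ultimately show ?thesis
    using g y by (auto simp: branchings_def branching_def single_valued_def)
qed

lemma remove_branchings:
  assumes E: "E \<in> branchings S" and uy: "(u, y) \<in> E"
  shows "E - {(u, y)} \<in> branchings (insert u S)" "(y, u) \<notin> (E - {(u, y)})\<^sup>*"
proof -
  have sv: "single_valued E" and ac: "acyclic E" and D: "Domain E = - S"
    using E by (auto simp: branchings_def branching_def)
  have "Domain (E - {(u, y)}) = - insert u S"
    using D sv uy by (auto simp: single_valued_def Domain_iff set_eq_iff) 
  then show "E - {(u, y)} \<in> branchings (insert u S)"
    using sv ac by (auto simp: branchings_def branching_def single_valued_def intro: acyclic_subset)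
  have "acyclic (insert (u, y) (E - {(u, y)}))" using ac uy by (simp add: insert_absorb)
  then show "(y, u) \<notin> (E - {(u, y)})\<^sup>*" unfolding acyclic_insert by blast
qed

text \<open>
  The bijection behind all forest identities: a branching is a smaller one, with \<open>u\<close> as an additional root,
  together with the head of the out-arc of \<open>u\<close>.
\<close>

lemma sum_branchings_insert:
  fixes h :: "'v::finite rel \<Rightarrow> real"
  assumes u: "u \<notin> S"
  shows "(\<Sum>E\<in>branchings S. h E) =
    (\<Sum>g\<in>branchings (insert u S). \<Sum>y\<in>{y. (y, u) \<notin> g\<^sup>*}. h (insert (u, y) g))"
proof -
  let ?X = "SIGMA g:branchings (insert u S). {y. (y, u) \<notin> g\<^sup>*}"
  have "(\<Sum>(g, y)\<in>?X. h (insert (u, y) g)) = (\<Sum>E\<in>branchings S. h E)"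
  proof (rule sum.reindex_bij_witness[where j = "\<lambda>(g, y). insert (u, y) g"
      and i = "\<lambda>E. let y = (THE y. (u, y) \<in> E) in (E - {(u, y)}, y)"])
    fix a assume "a \<in> ?X"
    then obtain g y where a: "a = (g, y)" "g \<in> branchings (insert u S)" "(y, u) \<notin> g\<^sup>*" by auto
    have n: "(u, z) \<notin> g" for z using a by (auto simp: branchings_def)
    then have "(THE z. (u, z) \<in> insert (u, y) g) = y" by auto
    then show "(let z = (THE z. (u, z) \<in> (case a of (g, y) \<Rightarrow> insert (u, y) g))
        in ((case a of (g, y) \<Rightarrow> insert (u, y) g) - {(u, z)}, z)) = a"
      using n by (auto simp: a Let_def)
    show "(case a of (g, y) \<Rightarrow> insert (u, y) g) \<in> branchings S"
      using insert_branchings a u by auto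
  next
    fix E assume E: "E \<in> branchings S"
    then obtain y where y: "(u, y) \<in> E" using u by (auto simp: branchings_def)
    then have the: "(THE y. (u, y) \<in> E) = y"
      using E by (auto simp: branchings_def branching_def single_valued_def)
    show "(case let y = THE y. (u, y) \<in> E in (E - {(u, y)}, y) of (g, y) \<Rightarrow> insert (u, y) g) = E"
      using y by (auto simp: the Let_def)
    show "(let y = THE y. (u, y) \<in> E in (E - {(u, y)}, y)) \<in> ?X"
      using remove_branchings[OF E y] by (auto simp: the Let_def)
  qed auto
  then show ?thesis by (subst sum.Sigma) auto
qed

section \<open>Weighted sums over branchings and the Laplacian\<close>

definition arcs_weight :: "('v \<times> 'v \<Rightarrow> real) \<Rightarrow> 'v rel \<Rightarrow> real" where
  "arcs_weight \<omega> E = (\<Prod>e\<in>E. \<omega> e)"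

text \<open>
  This is \<open>\<tau>\<^sub>v\<close>. The sum is over branchings of the complete digraph on the vertex type; those
  that use a non-arc of the given digraph have weight zero.
\<close>

definition branching_total :: "('v::finite \<times> 'v \<Rightarrow> real) \<Rightarrow> 'v \<Rightarrow> real" where
  "branching_total \<omega> v = (\<Sum>E\<in>branchings {v}. arcs_weight \<omega> E)"

definition reach_total :: "('v::finite \<times> 'v \<Rightarrow> real) \<Rightarrow> 'v \<Rightarrow> 'v \<Rightarrow> 'v \<Rightarrow> real" where
  "reach_total \<omega> v r x =
     (\<Sum>E\<in>branchings {r, v}. arcs_weight \<omega> E * of_bool ((x, r) \<in> E\<^sup>*))"

lemma arcs_weight_insert:
  fixes g :: "'v::finite rel"
  assumes "g \<in> branchings (insert u S)"
  shows "arcs_weight \<omega> (insert (u, y) g) = arcs_weight \<omega> g * \<omega> (u, y)"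
proof -
  have "(u, y) \<notin> g" using assms by (auto simp: branchings_def)
  then show ?thesis by (simp add: arcs_weight_def)
qed

text \<open>
  The weight of the arcs by which \<open>u\<close> can be attached to the tree of \<open>s\<close>.
\<close>

definition out_weight :: "('v::finite \<times> 'v \<Rightarrow> real) \<Rightarrow> 'v rel \<Rightarrow> 'v \<Rightarrow> 'v \<Rightarrow> real" where
  "out_weight \<omega> g u s = (\<Sum>y\<in>UNIV. \<omega> (u, y) * of_bool ((y, s) \<in> g\<^sup>*))"

text \<open>
  The head of each arc leaving \<open>u\<close> lies in the tree of exactly one root.
\<close>

lemma weighted_degree_out_weight:
  fixes \<omega> :: "'v::finite \<times> 'v \<Rightarrow> real"
  assumes g: "g \<in> branchings S"
  shows "weighted_degree \<omega> u = (\<Sum>s\<in>S. out_weight \<omega> g u s)"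
proof -
  have one: "(\<Sum>s\<in>S. of_bool ((y, s) \<in> g\<^sup>*)) = (1 :: real)" for y
  proof -
    obtain t where t: "t \<in> S" and iff: "\<And>s. s \<in> S \<Longrightarrow> (y, s) \<in> g\<^sup>* \<longleftrightarrow> s = t"
      using branchings_root[OF g, of y] by blast
    have "(\<Sum>s\<in>S. of_bool ((y, s) \<in> g\<^sup>*)) = (\<Sum>s\<in>S. if s = t then 1 else 0 :: real)"
      using iff by (intro sum.cong) simp_all
    then show ?thesis using t by simp
  qed
  then show ?thesis
    unfolding out_weight_def weighted_degree_def
    by (subst sum.swap) (simp only: sum_distrib_left[symmetric] one mult_1_right)
qed

lemma reach_total_remove_root:
  fixes \<omega> :: "'v::finite \<times> 'v \<Rightarrow> real"
  shows "(\<Sum>w\<in>UNIV. \<omega> (u, w) * reach_total \<omega> v r w) =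
    (\<Sum>g\<in>branchings {r, v}. arcs_weight \<omega> g * out_weight \<omega> g u r)"
  unfolding reach_total_def out_weight_def sum_distrib_left
  by (subst sum.swap) (simp add: algebra_simps)

lemma branching_total_remove:
  fixes \<omega> :: "'v::finite \<times> 'v \<Rightarrow> real"
  assumes "u \<noteq> v"
  shows "branching_total \<omega> v = (\<Sum>g\<in>branchings {u, v}. arcs_weight \<omega> g * out_weight \<omega> g u v)"
proof -
  have "branching_total \<omega> v = (\<Sum>g\<in>branchings (insert u {v}). \<Sum>y\<in>{y. (y, u) \<notin> g\<^sup>*}.
       arcs_weight \<omega> (insert (u, y) g))"
    unfolding branching_total_def using assms by (intro sum_branchings_insert) auto
  also have "\<dots> = (\<Sum>g\<in>branchings {u, v}. arcs_weight \<omega> g * out_weight \<omega> g u v)"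
  proof (intro sum.cong refl)
    fix g assume g: "g \<in> branchings {u, v}"
    have "\<And>y. (y, u) \<notin> g\<^sup>* \<longleftrightarrow> (y, v) \<in> g\<^sup>*" using branchings_root[OF g] assms by blast
    then show "(\<Sum>y\<in>{y. (y, u) \<notin> g\<^sup>*}. arcs_weight \<omega> (insert (u, y) g))
        = arcs_weight \<omega> g * out_weight \<omega> g u v"
      using g unfolding out_weight_def sum_distrib_left
      by (intro sum.mono_neutral_cong_left) (auto simp: arcs_weight_insert)
  qed
  finally show ?thesis .
qed

text \<open>
  Cut the out-arc of \<open>u\<close>, and let \<open>y\<close> be its head: \<open>x\<close> reached \<open>r\<close> either without passing through \<open>u\<close>,
  with \<open>y\<close> in the tree of \<open>r\<close> or of \<open>v\<close>, or through \<open>u\<close>, with \<open>y\<close> in the tree of \<open>r\<close>.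
\<close>

lemma reach_total_remove:
  fixes \<omega> :: "'v::finite \<times> 'v \<Rightarrow> real"
  assumes rv: "r \<noteq> v" and u: "u \<noteq> r" "u \<noteq> v"
  shows "reach_total \<omega> v r x = (\<Sum>g\<in>branchings {u, r, v}. arcs_weight \<omega> g *
    (of_bool ((x, r) \<in> g\<^sup>*) * (out_weight \<omega> g u r + out_weight \<omega> g u v)
      + of_bool ((x, u) \<in> g\<^sup>*) * out_weight \<omega> g u r))"
proof -
  have "reach_total \<omega> v r x = (\<Sum>g\<in>branchings (insert u {r, v}). \<Sum>y\<in>{y. (y, u) \<notin> g\<^sup>*}.
       arcs_weight \<omega> (insert (u, y) g) * of_bool ((x, r) \<in> (insert (u, y) g)\<^sup>*))"
    unfolding reach_total_def using u by (intro sum_branchings_insert) auto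
  also have "\<dots> = (\<Sum>g\<in>branchings {u, r, v}. arcs_weight \<omega> g *
    (of_bool ((x, r) \<in> g\<^sup>*) * (out_weight \<omega> g u r + out_weight \<omega> g u v)
      + of_bool ((x, u) \<in> g\<^sup>*) * out_weight \<omega> g u r))"
  proof (intro sum.cong refl)
    fix g assume g: "g \<in> branchings {u, r, v}"
    have root: "\<exists>!s. s \<in> {u, r, v} \<and> (y, s) \<in> g\<^sup>*" for y using branchings_root[OF g] .
    have "(\<Sum>y\<in>{y. (y, u) \<notin> g\<^sup>*}. arcs_weight \<omega> (insert (u, y) g)
          * of_bool ((x, r) \<in> (insert (u, y) g)\<^sup>*)) =
        (\<Sum>y\<in>UNIV. arcs_weight \<omega> g * (\<omega> (u, y) *
          (of_bool ((x, r) \<in> g\<^sup>*) * (of_bool ((y, r) \<in> g\<^sup>*) + of_bool ((y, v) \<in> g\<^sup>*))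
           + of_bool ((x, u) \<in> g\<^sup>*) * of_bool ((y, r) \<in> g\<^sup>*))))"
    proof (intro sum.mono_neutral_cong_left ballI)
      fix y assume "y \<in> UNIV - {y. (y, u) \<notin> g\<^sup>*}"
      then have "(y, r) \<notin> g\<^sup>*" "(y, v) \<notin> g\<^sup>*" using root[of y] u by blast+
      then show "arcs_weight \<omega> g * (\<omega> (u, y) *
          (of_bool ((x, r) \<in> g\<^sup>*) * (of_bool ((y, r) \<in> g\<^sup>*) + of_bool ((y, v) \<in> g\<^sup>*))
           + of_bool ((x, u) \<in> g\<^sup>*) * of_bool ((y, r) \<in> g\<^sup>*))) = 0" by simp
    next
      fix y assume "y \<in> {y. (y, u) \<notin> g\<^sup>*}"
      then have y: "(y, v) \<in> g\<^sup>* \<longleftrightarrow> (y, r) \<notin> g\<^sup>*" using root[of y] rv by blast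
      have x: "\<not> ((x, r) \<in> g\<^sup>* \<and> (x, u) \<in> g\<^sup>*)" using root[of x] u by blast
      have "(x, r) \<in> (insert (u, y) g)\<^sup>* \<longleftrightarrow> (x, r) \<in> g\<^sup>* \<or> (x, u) \<in> g\<^sup>* \<and> (y, r) \<in> g\<^sup>*"
        by (auto simp: rtrancl_insert)
      then show "arcs_weight \<omega> (insert (u, y) g) * of_bool ((x, r) \<in> (insert (u, y) g)\<^sup>*) =
        arcs_weight \<omega> g * (\<omega> (u, y) *
          (of_bool ((x, r) \<in> g\<^sup>*) * (of_bool ((y, r) \<in> g\<^sup>*) + of_bool ((y, v) \<in> g\<^sup>*))
           + of_bool ((x, u) \<in> g\<^sup>*) * of_bool ((y, r) \<in> g\<^sup>*)))"
        using x y by (auto simp: arcs_weight_insert[OF g])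
    qed auto
    also have "\<dots> = arcs_weight \<omega> g *
    (of_bool ((x, r) \<in> g\<^sup>*) * (out_weight \<omega> g u r + out_weight \<omega> g u v)
      + of_bool ((x, u) \<in> g\<^sup>*) * out_weight \<omega> g u r)"
      unfolding out_weight_def sum_distrib_left sum.distrib[symmetric] distrib_left
      by (intro sum.cong refl) (simp add: algebra_simps)
    finally show "(\<Sum>y\<in>{y. (y, u) \<notin> g\<^sup>*}. arcs_weight \<omega> (insert (u, y) g)
          * of_bool ((x, r) \<in> (insert (u, y) g)\<^sup>*)) = \<dots>" .
  qed
  finally show ?thesis .
qed

text \<open>
  The identity is compared term by term. For \<open>u\<close> one of the two roots the terms are indexed by the
  branchings with roots \<open>r\<close> and \<open>v\<close>; attaching \<open>u\<close> to the tree of the other root produces the spanning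
  trees. For any other \<open>u\<close> they are indexed by the branchings with roots \<open>u\<close>, \<open>r\<close>, \<open>v\<close>. With \<open>a\<close>, \<open>b\<close>, \<open>c\<close> the
  weights by which \<open>u\<close> attaches to the trees of \<open>r\<close>, \<open>v\<close>, \<open>u\<close>, both sides contribute \<open>(a + b + c) a\<close>.
\<close>

theorem reach_total_laplacian:
  fixes \<omega> :: "'v::finite \<times> 'v \<Rightarrow> real"
  assumes rv: "r \<noteq> v"
  shows "weighted_degree \<omega> u * reach_total \<omega> v r u - (\<Sum>w\<in>UNIV. \<omega> (u, w) * reach_total \<omega> v r w)
    = branching_total \<omega> v * of_bool (u = r) - branching_total \<omega> r * of_bool (u = v)"
proof -
  consider "u = r" | "u = v" | "u \<noteq> r" "u \<noteq> v" by blast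
  then show ?thesis
  proof cases
    case 1
    have "weighted_degree \<omega> r * reach_total \<omega> v r r =
        (\<Sum>g\<in>branchings {r, v}. arcs_weight \<omega> g * (out_weight \<omega> g r r + out_weight \<omega> g r v))"
      using rv unfolding reach_total_def sum_distrib_left
      by (intro sum.cong) (auto simp: weighted_degree_out_weight)
    then show ?thesis
      using rv 1 unfolding reach_total_remove_root branching_total_remove[OF rv]
      by (simp add: distrib_left sum.distrib)
  next
    case 2
    have "reach_total \<omega> v r v = 0"
      using rv by (auto simp: reach_total_def branchings_reach_root intro!: sum.neutral)
    then show ?thesis
      using rv 2 unfolding reach_total_remove_root branching_total_remove[OF rv[symmetric]]
      by (simp add: insert_commute)
  next
    case 3
    let ?o = "\<lambda>g. out_weight \<omega> g u"
    have "weighted_degree \<omega> u * reach_total \<omega> v r u = (\<Sum>g\<in>branchings {u, r, v}.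
        arcs_weight \<omega> g * (?o g u + ?o g r + ?o g v) * ?o g r)"
      unfolding reach_total_remove[OF rv 3] sum_distrib_left
    proof (intro sum.cong refl)
      fix g assume g: "g \<in> branchings {u, r, v}"
      have "weighted_degree \<omega> u = ?o g u + ?o g r + ?o g v"
        using weighted_degree_out_weight[OF g, of \<omega> u] rv 3 by simp
      moreover have "(u, r) \<notin> g\<^sup>*" using branchings_reach_root[OF g] 3 by auto
      ultimately show "weighted_degree \<omega> u * (arcs_weight \<omega> g *
          (of_bool ((u, r) \<in> g\<^sup>*) * (?o g r + ?o g v) + of_bool ((u, u) \<in> g\<^sup>*) * ?o g r))
        = arcs_weight \<omega> g * (?o g u + ?o g r + ?o g v) * ?o g r" by simp
    qed
    moreover have "(\<Sum>w\<in>UNIV. \<omega> (u, w) * reach_total \<omega> v r w) = (\<Sum>g\<in>branchings {u, r, v}.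
        arcs_weight \<omega> g * (?o g r * (?o g r + ?o g v) + ?o g u * ?o g r))"
    proof -
      have "(\<Sum>w\<in>UNIV. \<omega> (u, w) * reach_total \<omega> v r w) =
        (\<Sum>g\<in>branchings {u, r, v}. \<Sum>w\<in>UNIV. \<omega> (u, w) * (arcs_weight \<omega> g *
          (of_bool ((w, r) \<in> g\<^sup>*) * (?o g r + ?o g v) + of_bool ((w, u) \<in> g\<^sup>*) * ?o g r)))"
        unfolding reach_total_remove[OF rv 3] sum_distrib_left by (subst sum.swap) simp
      also have "\<dots> = (\<Sum>g\<in>branchings {u, r, v}. arcs_weight \<omega> g *
          ((\<Sum>w\<in>UNIV. \<omega> (u, w) * of_bool ((w, r) \<in> g\<^sup>*)) * (?o g r + ?o g v)
            + (\<Sum>w\<in>UNIV. \<omega> (u, w) * of_bool ((w, u) \<in> g\<^sup>*)) * ?o g r))"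
        unfolding sum_distrib_left sum_distrib_right sum.distrib[symmetric]
        by (intro sum.cong refl) (simp add: algebra_simps)
      finally show ?thesis unfolding out_weight_def .
    qed
    ultimately show ?thesis using 3 by (simp add: algebra_simps)
  qed
qed

section \<open>The Markov chain tree theorem\<close>

text \<open>
  A spanning tree with root \<open>v\<close> is obtained by sending every other vertex to an out-neighbour that is
  one step nearer to \<open>v\<close>.
\<close>

lemma branching_total_pos:
  fixes \<omega> :: "'v::finite \<times> 'v \<Rightarrow> real"
  assumes nonneg: "\<And>e. \<omega> e \<ge> 0" and reach: "\<And>x. (x, v) \<in> {e. \<omega> e > 0}\<^sup>*"
  shows "branching_total \<omega> v > 0"
proof -
  \<comment> \<open>\<open>n x\<close> is the distance from \<open>x\<close> to \<open>v\<close>.\<close>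
  define n where "n x = (LEAST k. (x, v) \<in> {e. \<omega> e > 0} ^^ k)" for x
  have n: "(x, v) \<in> {e. \<omega> e > 0} ^^ n x" for x
    unfolding n_def using reach[of x] by (auto simp: rtrancl_power intro: LeastI)
  have "\<exists>y. \<omega> (x, y) > 0 \<and> n y < n x" if neq: "x \<noteq> v" for x
  proof -
    obtain k where k: "n x = Suc k" using n[of x] neq by (cases "n x") auto
    then obtain y where y: "\<omega> (x, y) > 0" "(y, v) \<in> {e. \<omega> e > 0} ^^ k"
      using n[of x] relpow_Suc_D2[of x v k "{e. \<omega> e > 0}"] by auto
    then have "n y \<le> k" unfolding n_def by (intro Least_le)
    then show ?thesis using y k by auto
  qed
  then obtain f where f: "\<And>x. x \<noteq> v \<Longrightarrow> \<omega> (x, f x) > 0 \<and> n (f x) < n x" by metis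
  define E where "E = {(x, f x) |x. x \<noteq> v}"
  have "acyclic E" by (rule acyclicI_order[where f = n]) (auto simp: E_def f)
  then have E: "E \<in> branchings {v}"
    by (auto simp: branchings_def branching_def single_valued_def E_def)
  have "arcs_weight \<omega> E > 0" unfolding arcs_weight_def by (rule prod_pos) (auto simp: E_def f)
  then show ?thesis unfolding branching_total_def
    by (intro sum_pos2[OF _ E]) (auto simp: arcs_weight_def nonneg intro!: prod_nonneg)
qed

text \<open>
  Pair \<open>p\<close> with the Laplacian of \<open>reach_total \<omega> v r\<close>: the result is zero because \<open>p\<close> is a left null
  vector, and it is the difference of the two sides by \<open>reach_total_laplacian\<close>.
\<close>

lemma left_null_proportional:
  fixes \<omega> :: "'v::finite \<times> 'v \<Rightarrow> real"
  assumes p: "\<And>w. (\<Sum>u\<in>UNIV. p u * \<omega> (u, w)) = p w * weighted_degree \<omega> w"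
  shows "p r * branching_total \<omega> v = p v * branching_total \<omega> r"
proof (cases "r = v")
  case False
  let ?F = "reach_total \<omega> v r"
  have "(\<Sum>u\<in>UNIV. p u * (weighted_degree \<omega> u * ?F u - (\<Sum>w\<in>UNIV. \<omega> (u, w) * ?F w)))
      = (\<Sum>w\<in>UNIV. ?F w * (p w * weighted_degree \<omega> w - (\<Sum>u\<in>UNIV. p u * \<omega> (u, w))))"
    unfolding right_diff_distrib sum_subtractf sum_distrib_left
    by (subst (2) sum.swap) (simp add: algebra_simps)
  also have "\<dots> = 0" by (simp add: p)
  finally show ?thesis
    unfolding reach_total_laplacian[OF False] right_diff_distrib sum_subtractf
    by (simp add: of_bool_def mult.assoc[symmetric] if_distrib[of "(*) _"] cong: if_cong)
qed simp

lemma singular_left_null: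
  fixes M :: "real ^ 'n ^ 'n"
  assumes "M *v x = 0" "x \<noteq> 0"
  obtains p where "p v* M = 0" "p \<noteq> 0"
proof -
  have "\<not> (\<exists>C. C ** M = mat 1)" using assms matrix_left_invertible_ker by blast
  then have "\<not> (\<exists>C. C ** transpose M = mat 1)"
    by (metis matrix_left_right_inverse matrix_transpose_mul transpose_mat transpose_transpose)
  then obtain p where "transpose M *v p = 0" "p \<noteq> 0" using matrix_left_invertible_ker by blast
  then show thesis by (intro that) (simp_all add: transpose_matrix_vector)
qed

text \<open>
  The balance equation of the Markov chain tree theorem. The constant vector is a right null vector of the
  Laplacian, so there is a nonzero left null vector, and every left null vector is proportional
  to \<open>\<tau>\<close>.
\<close>

lemma branching_total_balance:
  fixes \<omega> :: "'v::finite \<times> 'v \<Rightarrow> real"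
  assumes pos: "\<And>v. branching_total \<omega> v > 0"
  shows "(\<Sum>u\<in>UNIV. branching_total \<omega> u * \<omega> (u, w)) = branching_total \<omega> w * weighted_degree \<omega> w"
proof -
  let ?L = "\<chi> i j. (if i = j then weighted_degree \<omega> i else 0) - \<omega> (i, j)"
  have "?L *v 1 = 0"
    by (simp add: vec_eq_iff matrix_vector_mult_def sum_subtractf weighted_degree_def)
  then obtain p where p: "p v* ?L = 0" "p \<noteq> 0" by (rule singular_left_null) auto
  have bal: "(\<Sum>u\<in>UNIV. p $ u * \<omega> (u, w)) = p $ w * weighted_degree \<omega> w" for w
  proof -
    have "(p v* ?L) $ w =
        (\<Sum>u\<in>UNIV. (if u = w then p $ w * weighted_degree \<omega> w else 0) - p $ u * \<omega> (u, w))"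
      unfolding vector_matrix_mult_def by (simp, intro sum.cong) (auto simp: algebra_simps)
    then show ?thesis by (simp add: p(1) sum_subtractf)
  qed
  obtain v where v: "p $ v \<noteq> 0" using p(2) by (auto simp: vec_eq_iff)
  define c where "c = branching_total \<omega> v / p $ v"
  have "branching_total \<omega> r = c * p $ r" for r
    using left_null_proportional[of "($) p" \<omega> r v, OF bal] v by (simp add: c_def field_simps)
  then show ?thesis using bal[of w] by (simp add: sum_distrib_left[symmetric] mult.assoc)
qed

lemma diag_mat_mult_left: "(diag_mat f ** M) $ i $ j = f i * M $ i $ j"
  by (simp add: diag_mat_def matrix_matrix_mult_def if_distrib if_distribR cong: if_cong)

lemma diag_mat_mult_right: "(M ** diag_mat f) $ i $ j = M $ i $ j * f j"
  by (simp add: diag_mat_def matrix_matrix_mult_def if_distrib if_distribR cong: if_cong)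

lemma matrix_inv_eqI:
  fixes A B :: "real ^ 'n ^ 'n"
  assumes "A ** B = mat 1" "B ** A = mat 1"
  shows "matrix_inv A = B"
proof -
  have "A ** matrix_inv A = mat 1 \<and> matrix_inv A ** A = mat 1"
    unfolding matrix_inv_def by (rule someI[of _ B]) (use assms in blast)
  then show ?thesis using assms by (metis matrix_mul_assoc matrix_mul_lid matrix_mul_rid)
qed

lemma matrix_inv_diag_mat:
  assumes "\<And>i. f i \<noteq> 0"
  shows "matrix_inv (diag_mat f) = diag_mat (\<lambda>i. 1 / f i)"
proof -
  have "diag_mat f ** diag_mat (\<lambda>i. 1 / f i) = mat 1" "diag_mat (\<lambda>i. 1 / f i) ** diag_mat f = mat 1"
    using assms by (auto simp: vec_eq_iff diag_mat_mult_left) (auto simp: diag_mat_def mat_def)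
  then show ?thesis by (rule matrix_inv_eqI)
qed

lemma transition_matrix_component:
  fixes \<omega> :: "'v::finite \<times> 'v \<Rightarrow> real"
  assumes "\<And>u. weighted_degree \<omega> u > 0"
  shows "transition_matrix \<omega> $ u $ w = \<omega> (u, w) / weighted_degree \<omega> u"
  using assms by (simp add: transition_matrix_def matrix_inv_diag_mat less_imp_neq[symmetric]
      diag_mat_mult_left adj_matrix_def)

text \<open>
  The constant \<open>K\<close> that normalizes \<open>d\<^sub>u \<tau>\<^sub>u\<close> to the stationary distribution.
\<close>

definition total_degree_weight :: "('v::finite \<times> 'v \<Rightarrow> real) \<Rightarrow> real" where
  "total_degree_weight \<omega> = (\<Sum>u\<in>UNIV. weighted_degree \<omega> u * branching_total \<omega> u)"

text \<open>
  If \<open>p\<close> is stationary, then \<open>p u / d u\<close> is a left null vector of the unnormalized Laplacian, hence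
  proportional to \<open>\<tau>\<close>; together with total mass 1 this leaves only one candidate.
\<close>

lemma
  fixes \<omega> :: "'v::finite \<times> 'v \<Rightarrow> real"
  assumes d: "\<And>u. weighted_degree \<omega> u > 0" and t: "\<And>u. branching_total \<omega> u > 0"
  shows is_stationary_stationary: "is_stationary \<omega> (stationary \<omega>)"
    and stationary_tree_formula: "stationary \<omega> $ u = weighted_degree \<omega> u * branching_total \<omega> u / total_degree_weight \<omega>"
proof -
  define K where "K = total_degree_weight \<omega>"
  define q :: "real ^ 'v" where "q = (\<chi> u. weighted_degree \<omega> u * branching_total \<omega> u / K)"
  have K: "K > 0" unfolding K_def total_degree_weight_def
    using d t by (intro sum_pos) auto
  have tm: "(p v* transition_matrix \<omega>) $ w = (\<Sum>u\<in>UNIV. p $ u / weighted_degree \<omega> u * \<omega> (u, w))" for p w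
    by (simp add: vector_matrix_mult_def transition_matrix_component[OF d] mult.commute)
  have "(q v* transition_matrix \<omega>) $ w = q $ w" for w
  proof -
    have "(q v* transition_matrix \<omega>) $ w = (\<Sum>u\<in>UNIV. branching_total \<omega> u * \<omega> (u, w)) / K"
      unfolding tm sum_divide_distrib using d by (intro sum.cong) (auto simp: q_def less_imp_neq[symmetric])
    then show ?thesis by (simp add: branching_total_balance[OF t] q_def mult.commute)
  qed
  moreover have "(\<Sum>u\<in>UNIV. q $ u) = 1"
    using K by (simp add: q_def sum_divide_distrib[symmetric] K_def total_degree_weight_def)
  ultimately have q: "is_stationary \<omega> q"
    using d t K by (auto simp: is_stationary_def vec_eq_iff q_def)
  have unique: "p = q" if p: "is_stationary \<omega> p" for p
  proof -
    let ?p = "\<lambda>u. p $ u / weighted_degree \<omega> u"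
    have "(\<Sum>u\<in>UNIV. ?p u * \<omega> (u, w)) = ?p w * weighted_degree \<omega> w" for w
      using p d[of w] tm[of p w] by (simp add: is_stationary_def)
    note proportional = left_null_proportional[OF this]
    have "p $ r = q $ r" for r
    proof -
      have "p $ r * (weighted_degree \<omega> v * branching_total \<omega> v) =
          weighted_degree \<omega> r * branching_total \<omega> r * p $ v" for v
        using proportional[of r v] d[of r] d[of v] by (simp add: field_simps)
      then have "p $ r * K = weighted_degree \<omega> r * branching_total \<omega> r * (\<Sum>v\<in>UNIV. p $ v)"
        unfolding K_def total_degree_weight_def sum_distrib_left by simp
      then show ?thesis using p K by (simp add: is_stationary_def q_def field_simps)
    qed
    then show ?thesis by (simp add: vec_eq_iff)
  qed
  have "stationary \<omega> = q" unfolding stationary_def using q unique by blast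
  then show "is_stationary \<omega> (stationary \<omega>)"
    and "stationary \<omega> $ u = weighted_degree \<omega> u * branching_total \<omega> u / total_degree_weight \<omega>"
    using q by (auto simp: q_def K_def)
qed

section \<open>The Moore--Penrose inverse of a matrix of corank one\<close>

text \<open>
  Uniqueness of the Moore--Penrose inverse: the products \<open>M ** Y\<close> and \<open>Y ** M\<close> are the orthogonal projections
  onto the range and the row space of \<open>M\<close>, hence the same for all candidates \<open>Y\<close>, and \<open>Y = Y ** M ** Y\<close>.
\<close>

lemma moore_penrose_eqI:
  assumes X: "is_moore_penrose M X"
  shows "moore_penrose M = X"
proof -
  have "Y = X" if Y: "is_moore_penrose M Y" for Y
  proof -
    have MYMX: "M ** Y = M ** X"
    proof -
      have "M ** Y = transpose (M ** Y)" using Y by (simp add: is_moore_penrose_def)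
      also have "\<dots> = transpose (M ** X ** M ** Y)" using X by (simp add: is_moore_penrose_def)
      also have "\<dots> = transpose (M ** Y) ** transpose (M ** X)"
        by (simp add: matrix_transpose_mul matrix_mul_assoc)
      also have "\<dots> = M ** Y ** (M ** X)" using X Y by (simp add: is_moore_penrose_def matrix_mul_assoc)
      finally show ?thesis using Y by (simp add: is_moore_penrose_def matrix_mul_assoc)
    qed
    have YMXM: "Y ** M = X ** M"
    proof -
      have "Y ** M = transpose (Y ** M)" using Y by (simp add: is_moore_penrose_def)
      also have "\<dots> = transpose (Y ** (M ** X ** M))" using X by (simp add: is_moore_penrose_def)
      also have "\<dots> = transpose (X ** M) ** transpose (Y ** M)"
        by (simp add: matrix_transpose_mul matrix_mul_assoc)
      also have "\<dots> = X ** M ** (Y ** M)" using X Y by (simp add: is_moore_penrose_def)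
      also have "\<dots> = X ** (M ** Y ** M)" by (simp add: matrix_mul_assoc)
      finally show ?thesis using Y by (simp add: is_moore_penrose_def)
    qed
    have "Y = Y ** (M ** Y)" using Y by (simp add: is_moore_penrose_def matrix_mul_assoc)
    also have "\<dots> = X ** M ** X" by (simp add: MYMX matrix_mul_assoc YMXM)
    finally show ?thesis using X by (simp add: is_moore_penrose_def)
  qed
  then show ?thesis unfolding moore_penrose_def using X by blast
qed

lemma matrix_add_rdistrib: "(A + B) ** C = A ** C + B ** (C :: real ^ 'n ^ 'm)"
  by (simp add: matrix_matrix_mult_def vec_eq_iff distrib_right sum.distrib)

lemma matrix_diff_rdistrib: "(A - B) ** C = A ** C - B ** (C :: real ^ 'n ^ 'm)"
  by (simp add: matrix_matrix_mult_def vec_eq_iff left_diff_distrib sum_subtractf)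

text \<open>
  As \<open>S\<close> is idempotent and \<open>M ** S = 0\<close>, the equations for \<open>M ** X\<close> and \<open>s v* X\<close> make \<open>X + S\<close> a right
  inverse of \<open>M + S\<close>.
  A right inverse of a square matrix is also a left inverse, and this yields the missing equations
  \<open>X ** S = 0\<close> and \<open>X ** M = mat 1 - S\<close>.
\<close>

lemma moore_penrose_corank_one:
  fixes M X :: "real ^ 'n ^ 'n" and s :: "real ^ 'n"
  defines "S \<equiv> \<chi> i j. s $ i * s $ j"
  assumes unit: "(\<Sum>i\<in>UNIV. s $ i * s $ i) = 1"
    and right: "M *v s = 0" and left: "s v* M = 0"
    and MX: "M ** X = mat 1 - S" and sX: "s v* X = 0"
  shows "moore_penrose M = X"
proof (rule moore_penrose_eqI)
  have SS: "S ** S = S"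
  proof -
    have "(\<Sum>k\<in>UNIV. s $ i * s $ k * (s $ k * s $ j)) = s $ i * s $ j * (\<Sum>k\<in>UNIV. s $ k * s $ k)"
      for i j by (simp add: sum_distrib_left algebra_simps)
    then show ?thesis by (simp add: S_def matrix_matrix_mult_def vec_eq_iff unit)
  qed
  have MS: "M ** S = 0"
  proof -
    have "(\<Sum>k\<in>UNIV. M $ i $ k * (s $ k * s $ j)) = (M *v s) $ i * s $ j" for i j
      by (simp add: matrix_vector_mult_def sum_distrib_right mult.assoc)
    then show ?thesis by (simp add: S_def matrix_matrix_mult_def vec_eq_iff right)
  qed
  have SN: "S ** N = 0" if "s v* N = 0" for N :: "real ^ 'n ^ 'n"
  proof -
    have "(\<Sum>k\<in>UNIV. s $ i * s $ k * N $ k $ j) = s $ i * (s v* N) $ j" for i j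
      by (simp add: vector_matrix_mult_def sum_distrib_left algebra_simps)
    then show ?thesis by (simp add: S_def matrix_matrix_mult_def vec_eq_iff that)
  qed
  have tS: "transpose S = S" by (simp add: S_def transpose_def vec_eq_iff mult.commute)
  have "(M + S) ** (X + S) = mat 1"
    by (simp add: matrix_add_ldistrib matrix_add_rdistrib MX MS SN[OF sX] SS)
  then have inv: "(X + S) ** (M + S) = mat 1" by (rule matrix_left_right_inverse[THEN iffD1])
  have "X ** S = (X + S) ** (M + S) ** S - S"
    by (simp add: matrix_mul_assoc[symmetric] matrix_add_ldistrib matrix_add_rdistrib MS SS)
  then have XS: "X ** S = 0" by (simp add: inv)
  have XM: "X ** M = mat 1 - S"
    using inv by (simp add: matrix_add_ldistrib matrix_add_rdistrib SN[OF left] SS XS eq_diff_eq)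
  have t1: "transpose (mat 1 - S) = mat 1 - S"
    using tS by (simp add: transpose_def vec_eq_iff mat_def)
  show "is_moore_penrose M X"
    unfolding is_moore_penrose_def MX XM t1
    by (simp add: matrix_diff_rdistrib SN left sX)
qed

section \<open>The normalized Green's function as a sum over branchings\<close>

text \<open>
  The difference of the two forest sums of the theorem, with a forest represented by its arc set
  and the roots \<open>v\<close> and \<open>r\<close> of its two trees.
\<close>

definition green_sum :: "('v::finite \<times> 'v \<Rightarrow> real) \<Rightarrow> 'v \<Rightarrow> 'v \<Rightarrow> real" where
  "green_sum \<omega> u v = (\<Sum>r\<in>- {v}. \<Sum>E\<in>branchings {r, v}. weighted_degree \<omega> r * arcs_weight \<omega> E *
     (of_bool ((u, v) \<in> E\<^sup>*) * (\<Sum>z | (z, r) \<in> E\<^sup>*. stationary \<omega> $ z) -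
      of_bool ((u, r) \<in> E\<^sup>*) * (\<Sum>z | (z, v) \<in> E\<^sup>*. stationary \<omega> $ z)))"

text \<open>
  After summation over \<open>u\<close>, each forest contributes the product of the masses of its trees once with
  each sign.
\<close>

lemma green_sum_centered:
  "(\<Sum>u\<in>UNIV. stationary \<omega> $ u * green_sum \<omega> u v) = 0"
proof -
  have "(\<Sum>u\<in>UNIV. stationary \<omega> $ u * (of_bool (u \<in> A) * b - of_bool (u \<in> B) * a)) =
      sum (($) (stationary \<omega>)) A * b - sum (($) (stationary \<omega>)) B * a" for A B a b
  proof -
    have "(\<Sum>u\<in>UNIV. stationary \<omega> $ u * of_bool (u \<in> C)) = sum (($) (stationary \<omega>)) C" for C
      by (rule sum.mono_neutral_cong_right) auto
    then show ?thesis
      by (simp add: right_diff_distrib sum_subtractf mult.assoc[symmetric] sum_distrib_right[symmetric]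
          del: sum_mult_of_bool_eq)
  qed
  note * = this[of "{x. (x, v) \<in> E\<^sup>*}" _ "{x. (x, r) \<in> E\<^sup>*}" for E r, unfolded mem_Collect_eq]
  have "(\<Sum>u\<in>UNIV. stationary \<omega> $ u * green_sum \<omega> u v) =
    (\<Sum>r\<in>- {v}. \<Sum>E\<in>branchings {r, v}. weighted_degree \<omega> r * arcs_weight \<omega> E *
     (\<Sum>u\<in>UNIV. stationary \<omega> $ u * (of_bool ((u, v) \<in> E\<^sup>*) * (\<Sum>z | (z, r) \<in> E\<^sup>*. stationary \<omega> $ z) -
      of_bool ((u, r) \<in> E\<^sup>*) * (\<Sum>z | (z, v) \<in> E\<^sup>*. stationary \<omega> $ z))))"
    unfolding green_sum_def sum_distrib_left
    by (subst sum.swap, rule sum.cong[OF refl], subst sum.swap) (simp add: algebra_simps)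
  also have "\<dots> = 0" unfolding * by simp
  finally show ?thesis .
qed

text \<open>
  If \<open>m r\<close> and \<open>m v\<close> are the masses of the two trees, then \<open>m r + m v = 1\<close>; so the coefficient of a
  forest, which is \<open>m r\<close> or \<open>- m v\<close>, is \<open>m r\<close> minus 1 if \<open>u\<close> is in the tree of \<open>r\<close>.
\<close>

lemma green_sum_reach_total:
  assumes one: "(\<Sum>z\<in>UNIV. stationary \<omega> $ z) = 1"
  shows "\<exists>c. \<forall>u. green_sum \<omega> u v = c - (\<Sum>r\<in>- {v}. weighted_degree \<omega> r * reach_total \<omega> v r u)"
proof -
  let ?c = "\<Sum>r\<in>- {v}. \<Sum>E\<in>branchings {r, v}. weighted_degree \<omega> r * arcs_weight \<omega> E *
     (\<Sum>z | (z, r) \<in> E\<^sup>*. stationary \<omega> $ z)"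
  have F: "weighted_degree \<omega> r * reach_total \<omega> v r u = (\<Sum>E\<in>branchings {r, v}.
      weighted_degree \<omega> r * (arcs_weight \<omega> E * of_bool ((u, r) \<in> E\<^sup>*)))" for r u
    unfolding reach_total_def by (rule sum_distrib_left)
  have "green_sum \<omega> u v = ?c - (\<Sum>r\<in>- {v}. weighted_degree \<omega> r * reach_total \<omega> v r u)" for u
    unfolding green_sum_def F sum_subtractf[symmetric]
  proof (intro sum.cong refl)
    fix r E assume r: "r \<in> - {v}" and E: "E \<in> branchings {r, v}"
    let ?m = "\<lambda>s. \<Sum>z | (z, s) \<in> E\<^sup>*. stationary \<omega> $ z"
    have iff: "(x, v) \<in> E\<^sup>* \<longleftrightarrow> (x, r) \<notin> E\<^sup>*" for x
      using branchings_root[OF E, of x] r by blast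
    have "?m r + ?m v = 1" 
      unfolding one[symmetric] by (subst sum.union_disjoint[symmetric]) (auto simp: iff intro!: sum.cong)
    then have m: "?m r = 1 - ?m v" by simp
    show "weighted_degree \<omega> r * arcs_weight \<omega> E *
       (of_bool ((u, v) \<in> E\<^sup>*) * ?m r - of_bool ((u, r) \<in> E\<^sup>*) * ?m v) =
       weighted_degree \<omega> r * arcs_weight \<omega> E * ?m r -
       weighted_degree \<omega> r * (arcs_weight \<omega> E * of_bool ((u, r) \<in> E\<^sup>*))"
      unfolding m iff[of u] by (cases "(u, r) \<in> E\<^sup>*") (simp_all add: algebra_simps)
  qed
  then show ?thesis by blast
qed

lemma green_sum_laplacian:
  assumes one: "(\<Sum>z\<in>UNIV. stationary \<omega> $ z) = 1"
  shows "weighted_degree \<omega> u * green_sum \<omega> u v - (\<Sum>w\<in>UNIV. \<omega> (u, w) * green_sum \<omega> w v)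
    = of_bool (u = v) * total_degree_weight \<omega> - weighted_degree \<omega> u * branching_total \<omega> v"
proof -
  \<comment> \<open>The constant disappears because the degree is the sum of the weights.\<close>
  obtain c where c: "\<And>u. green_sum \<omega> u v = c - (\<Sum>r\<in>- {v}. weighted_degree \<omega> r * reach_total \<omega> v r u)"
    using green_sum_reach_total[OF one] by blast
  have "weighted_degree \<omega> u * green_sum \<omega> u v - (\<Sum>w\<in>UNIV. \<omega> (u, w) * green_sum \<omega> w v) =
    (\<Sum>w\<in>UNIV. \<omega> (u, w) * (\<Sum>r\<in>- {v}. weighted_degree \<omega> r * reach_total \<omega> v r w))
    - weighted_degree \<omega> u * (\<Sum>r\<in>- {v}. weighted_degree \<omega> r * reach_total \<omega> v r u)"
    unfolding c right_diff_distrib sum_subtractf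
    by (simp add: weighted_degree_def sum_distrib_right)
  also have "\<dots> = - (\<Sum>r\<in>- {v}. weighted_degree \<omega> r *
      (weighted_degree \<omega> u * reach_total \<omega> v r u - (\<Sum>w\<in>UNIV. \<omega> (u, w) * reach_total \<omega> v r w)))"
    unfolding right_diff_distrib sum_subtractf sum_distrib_left
    by (subst sum.swap) (simp add: algebra_simps)
  also have "\<dots> = - (\<Sum>r\<in>- {v}. weighted_degree \<omega> r * branching_total \<omega> v * of_bool (u = r))
      + of_bool (u = v) * (\<Sum>r\<in>- {v}. weighted_degree \<omega> r * branching_total \<omega> r)"
    by (subst sum.cong[OF refl, where h = "\<lambda>r. weighted_degree \<omega> r * branching_total \<omega> v * of_bool (u = r)
          - of_bool (u = v) * (weighted_degree \<omega> r * branching_total \<omega> r)"])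
      (auto simp: reach_total_laplacian sum_subtractf sum_distrib_left algebra_simps)
  also have "(\<Sum>r\<in>- {v}. weighted_degree \<omega> r * branching_total \<omega> r) =
      total_degree_weight \<omega> - weighted_degree \<omega> v * branching_total \<omega> v"
    by (simp add: total_degree_weight_def Compl_eq_Diff_UNIV sum_diff1)
  also have "(\<Sum>r\<in>- {v}. weighted_degree \<omega> r * branching_total \<omega> v * of_bool (u = r)) =
      (if u = v then 0 else weighted_degree \<omega> u * branching_total \<omega> v)"
    by (simp add: of_bool_def if_distrib cong: if_cong)
  finally show ?thesis by (auto simp: algebra_simps)
qed

theorem normalized_green_green_sum:
  fixes \<omega> :: "'v::finite \<times> 'v \<Rightarrow> real"
  assumes d: "\<And>u. weighted_degree \<omega> u > 0" and t: "\<And>u. branching_total \<omega> u > 0"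
  shows "normalized_green \<omega> $ u $ v =
    sqrt (stationary \<omega> $ u * stationary \<omega> $ v) / branching_total \<omega> v * green_sum \<omega> u v"
proof -
  let ?p = "stationary \<omega>" and ?L = "normalized_laplacian \<omega>" and ?K = "total_degree_weight \<omega>"
  define s :: "real ^ 'v" where "s = (\<chi> u. sqrt (?p $ u))"
  define X :: "real ^ 'v ^ 'v" where
    "X = (\<chi> u v. sqrt (?p $ u * ?p $ v) / branching_total \<omega> v * green_sum \<omega> u v)"
  have stat: "is_stationary \<omega> ?p" using is_stationary_stationary[OF d t] .
  then have one: "(\<Sum>u\<in>UNIV. ?p $ u) = 1" and inv: "?p v* transition_matrix \<omega> = ?p"
    and p: "\<And>u. ?p $ u > 0" by (auto simp: is_stationary_def)
  have s: "s $ u > 0" "s $ u * s $ u = ?p $ u" for u using p[of u] by (simp_all add: s_def)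
  have X: "X $ u $ v = s $ u * s $ v / branching_total \<omega> v * green_sum \<omega> u v" for u v
    by (simp add: X_def s_def real_sqrt_mult)
  have L: "?L $ u $ w = s $ u * (of_bool (u = w) - \<omega> (u, w) / weighted_degree \<omega> u) / s $ w" for u w
    using s(1) by (simp add: normalized_laplacian_def sqrt_Pi_def s_def matrix_inv_diag_mat less_imp_neq[symmetric] p
       diag_mat_mult_left diag_mat_mult_right transition_matrix_component[OF d] mat_def of_bool_def)
  have "moore_penrose ?L = X"
  proof (rule moore_penrose_corank_one)
    show "(\<Sum>i\<in>UNIV. s $ i * s $ i) = 1" using one by (simp add: s(2))
    show "?L *v s = 0"
    proof (intro vec_eq_iff[THEN iffD2] allI)
      fix u
      have "(?L *v s) $ u = (\<Sum>w\<in>UNIV. s $ u * (of_bool (u = w) - \<omega> (u, w) / weighted_degree \<omega> u))"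
        unfolding matrix_vector_mult_def using s(1) by (simp add: L less_imp_neq[symmetric])
      also have "\<dots> = s $ u * (1 - weighted_degree \<omega> u / weighted_degree \<omega> u)"
        by (simp add: sum_distrib_left[symmetric] sum_subtractf weighted_degree_def sum_divide_distrib[symmetric])
      finally show "(?L *v s) $ u = 0 $ u" using d[of u] by simp
    qed
    show "s v* ?L = 0"
    proof (intro vec_eq_iff[THEN iffD2] allI)
      fix w
      have "(s v* ?L) $ w = (\<Sum>u\<in>UNIV. s $ u * s $ u * (of_bool (u = w) - \<omega> (u, w) / weighted_degree \<omega> u) / s $ w)"
        by (simp add: vector_matrix_mult_def L algebra_simps)
      also have "\<dots> = (?p $ w - (?p v* transition_matrix \<omega>) $ w) / s $ w"
        unfolding s(2)
        by (simp add: vector_matrix_mult_def transition_matrix_component[OF d] right_diff_distrib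
          sum_subtractf sum_divide_distrib[symmetric] mult.commute)
      finally show "(s v* ?L) $ w = 0 $ w" by (simp add: inv)
    qed
    show "?L ** X = mat 1 - (\<chi> i j. s $ i * s $ j)"
    proof (intro vec_eq_iff[THEN iffD2] allI)
      fix u v
      have K: "?p $ v = weighted_degree \<omega> v * branching_total \<omega> v / ?K"
        by (rule stationary_tree_formula[OF d t])
      have K0: "?K > 0" unfolding total_degree_weight_def using d t by (intro sum_pos) auto
      have "(?L ** X) $ u $ v = (\<Sum>w\<in>UNIV. s $ u * s $ v / branching_total \<omega> v *
          ((of_bool (u = w) - \<omega> (u, w) / weighted_degree \<omega> u) * green_sum \<omega> w v))"
        unfolding matrix_matrix_mult_def vec_lambda_beta
        using s(1) by (intro sum.cong refl) (simp add: L X less_imp_neq[symmetric])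
      also have "\<dots> = s $ u * s $ v / branching_total \<omega> v *
          (green_sum \<omega> u v - (\<Sum>w\<in>UNIV. \<omega> (u, w) * green_sum \<omega> w v) / weighted_degree \<omega> u)"
      proof -
        have "(\<Sum>w\<in>UNIV. (of_bool (u = w) - \<omega> (u, w) / weighted_degree \<omega> u) * green_sum \<omega> w v) =
            green_sum \<omega> u v - (\<Sum>w\<in>UNIV. \<omega> (u, w) * green_sum \<omega> w v) / weighted_degree \<omega> u"
          by (simp add: left_diff_distrib sum_subtractf sum_divide_distrib)
        then show ?thesis by (simp only: sum_distrib_left[symmetric])
      qed
      also have "\<dots> = s $ u * s $ v / branching_total \<omega> v *
          ((weighted_degree \<omega> u * green_sum \<omega> u v - (\<Sum>w\<in>UNIV. \<omega> (u, w) * green_sum \<omega> w v)) / weighted_degree \<omega> u)"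
        using d[of u] by (simp add: diff_divide_distrib)
      also have "\<dots> = s $ u * s $ v / branching_total \<omega> v *
          ((of_bool (u = v) * ?K - weighted_degree \<omega> u * branching_total \<omega> v) / weighted_degree \<omega> u)"
        unfolding green_sum_laplacian[OF one] ..
      also have "\<dots> = of_bool (u = v) - s $ u * s $ v"
      proof (cases "u = v")
        case True
        show ?thesis unfolding True s(2) using d[of v] t[of v] K0 by (simp add: K field_simps)
      next
        case False
        then show ?thesis using d[of u] t[of v] by simp
      qed
      finally show "(?L ** X) $ u $ v = (mat 1 - (\<chi> i j. s $ i * s $ j)) $ u $ v"
        by (simp add: mat_def)
    qed
    show "s v* X = 0"
    proof (intro vec_eq_iff[THEN iffD2] allI)
      fix v
      have "(s v* X) $ v = (\<Sum>u\<in>UNIV. s $ v / branching_total \<omega> v * (s $ u * s $ u * green_sum \<omega> u v))"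
        by (simp add: vector_matrix_mult_def X algebra_simps)
      then show "(s v* X) $ v = 0 $ v"
        unfolding s(2)
        by (simp only: sum_distrib_left[symmetric] green_sum_centered mult_zero_right zero_index)
    qed
  qed
  then show ?thesis by (simp add: normalized_green_def X_def)
qed

section \<open>Walks in digraphs given by pairs\<close>

lemma awalk_with_proj_iff:
  "pre_digraph.awalk (with_proj H) u p v \<longleftrightarrow> u \<in> pverts H \<and> set p \<subseteq> parcs H \<and> pcas u p v"
  by (simp add: pre_digraph.awalk_def cas_with_proj_eq)

lemma apath_with_proj_iff:
  "pre_digraph.apath (with_proj H) u p v \<longleftrightarrow>
    u \<in> pverts H \<and> set p \<subseteq> parcs H \<and> pcas u p v \<and> distinct (pawalk_verts u p)"
  by (simp add: pre_digraph.apath_def awalk_with_proj_iff awalk_verts_with_proj_eq)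

lemma cycle_with_proj_iff:
  "pre_digraph.cycle (with_proj H) p \<longleftrightarrow> (\<exists>u. u \<in> pverts H \<and> set p \<subseteq> parcs H \<and> pcas u p u \<and>
     distinct (tl (pawalk_verts u p)) \<and> p \<noteq> [])"
  by (simp add: pre_digraph.cycle_def awalk_with_proj_iff awalk_verts_with_proj_eq)

lemma parcs_mk_symmetric_with_proj: "parcs (mk_symmetric (with_proj H)) = parcs H \<union> (parcs H)\<inverse>"
  by (auto simp: parcs_mk_symmetric)

lemma pawalk_verts_reach:
  "pcas u p v \<Longrightarrow> set p \<subseteq> E \<Longrightarrow> x \<in> set (pawalk_verts u p) \<Longrightarrow> (u, x) \<in> E\<^sup>*"
proof (induction p arbitrary: u)
  case (Cons e p)
  then show ?case by (cases e) (auto intro: converse_rtrancl_into_rtrancl)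
qed simp

lemma pcas_unique:
  assumes "single_valued E" "s \<notin> Domain E"
  shows "pcas u p s \<Longrightarrow> pcas u q s \<Longrightarrow> set p \<subseteq> E \<Longrightarrow> set q \<subseteq> E \<Longrightarrow> p = q"
proof (induction p arbitrary: u q)
  case Nil
  then show ?case using assms(2) by (cases q) (auto simp: Domain_iff)
next
  case (Cons e p)
  obtain w where e: "e = (u, w)" using Cons.prems(1) by (cases e) auto
  then have "u \<noteq> s" using Cons.prems(3) assms(2) by auto
  then obtain e' q' where q: "q = e' # q'" using Cons.prems(2) by (cases q) auto
  then have "e' = (u, w)"
    using Cons.prems e assms(1) by (cases e') (auto simp: single_valued_def)
  then show ?case using Cons q e by auto
qed

lemma pcas_closed_nth:
  assumes "pcas u p u" "i < length p"
  shows "fst (p ! i) = snd (p ! (if i = 0 then length p - 1 else i - 1))"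
proof -
  have gen: "fst (p ! i) = (if i = 0 then u else snd (p ! (i - 1)))" "p \<noteq> [] \<Longrightarrow> v = snd (last p)"
    if "pcas u p v" "i < length p" for u v i and p :: "('a \<times> 'a) list"
    using that
  proof (induction p arbitrary: u i)
    case (Cons e p)
    { case 1 then show ?case using Cons.IH(1)[of "snd e" "i - 1"] by (cases i) (auto split: if_splits) }
    { case 2 then show ?case using Cons.IH(2)[of "snd e" 0] by (cases p) auto }
  qed simp_all
  show ?thesis
    using gen(1)[OF assms] gen(2)[OF assms] assms(2) by (auto simp: last_conv_nth)
qed

lemma tl_pawalk_verts: "pcas u p v \<Longrightarrow> tl (pawalk_verts u p) = map snd p"
proof -
  have "pcas u p v \<Longrightarrow> pawalk_verts u p = u # map snd p"
    by (induction p arbitrary: u) auto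
  then show "pcas u p v \<Longrightarrow> tl (pawalk_verts u p) = map snd p" by simp
qed

section \<open>Branchings and undirected cycles\<close>

text \<open>
  On an undirected cycle choose a vertex of maximal height. As arcs decrease the height, both
  cycle edges at this vertex are arcs leaving it, so they lead to the same vertex; on a cycle of
  length at least 3 the two neighbours differ.
\<close>

lemma branching_underlying_forest:
  fixes E :: "'v::finite rel"
  assumes E: "branching E"
  shows "underlying_forest \<lparr>pverts = UNIV, parcs = E\<rparr>"
proof -
  obtain h :: "'v \<Rightarrow> nat" where h: "\<And>x y. (x, y) \<in> E \<Longrightarrow> h y < h x"
    using branching_height[OF E] by blast
  have sv: "single_valued E" using E by (simp add: branching_def)
  have False if p: "set p \<subseteq> E \<union> E\<inverse>" "pcas u p u" "distinct (tl (pawalk_verts u p))" "length p \<ge> 3" for u p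
  proof -
    let ?n = "length p"
    let ?hs = "(\<lambda>i. h (snd (p ! i))) ` {..<?n}"
    have "Max ?hs \<in> ?hs" using p(4) by (intro Max_in) (auto simp: lessThan_empty_iff)
    then obtain i where i: "i < ?n" and "Max ?hs = h (snd (p ! i))" by auto
    then have max: "h (snd (p ! j)) \<le> h (snd (p ! i))" if "j < ?n" for j
      using that Max_ge[of ?hs "h (snd (p ! j))"] by auto
    \<comment> \<open>The cyclic successor and predecessor of \<open>i\<close>: the arcs at positions \<open>i\<close> and \<open>j\<close> meet in the highest vertex.\<close>
    define j where "j = (if Suc i = ?n then 0 else Suc i)"
    define k where "k = (if i = 0 then ?n - 1 else i - 1)"
    have jk: "j < ?n" "k < ?n" "j \<noteq> k" using i p(4) by (auto simp: j_def k_def)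
    have "fst (p ! i) = snd (p ! k)" using pcas_closed_nth[OF p(2) i] by (simp add: k_def)
    moreover have "fst (p ! j) = snd (p ! i)"
      using pcas_closed_nth[OF p(2) jk(1)] i
      by (cases "Suc i = ?n") (auto simp: j_def dest: sym)
    ultimately have "p ! i = (snd (p ! k), snd (p ! i))" "p ! j = (snd (p ! i), snd (p ! j))"
      by (simp_all add: prod_eq_iff)
    then have "(snd (p ! k), snd (p ! i)) \<in> E \<union> E\<inverse>" "(snd (p ! i), snd (p ! j)) \<in> E \<union> E\<inverse>"
      using p(1) i jk(1) by (metis nth_mem subsetD)+
    then have "(snd (p ! i), snd (p ! k)) \<in> E" "(snd (p ! i), snd (p ! j)) \<in> E"
      using h max[OF jk(1)] max[OF jk(2)] by (fastforce simp: not_less[symmetric])+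
    then have "snd (p ! k) = snd (p ! j)" using sv by (auto simp: single_valued_def)
    then show False using p(3) jk by (simp add: tl_pawalk_verts[OF p(2)] distinct_conv_nth)
  qed
  moreover have "(v, u) \<notin> E" if "(u, v) \<in> E" for u v using h[OF that] h[of v u] by auto
  ultimately show ?thesis
    unfolding underlying_forest_def cycle_with_proj_iff parcs_mk_symmetric_with_proj by auto
qed

text \<open>
  A directed cycle has length 1 (a loop), length 2 (two antiparallel arcs) or is an undirected
  cycle of length at least 3.
\<close>

lemma underlying_forest_acyclic:
  assumes "pair_digraph H" "underlying_forest H"
  shows "acyclic (parcs H)"
proof (rule acyclicI, safe)
  interpret pair_digraph H by fact
  fix x assume "(x, x) \<in> (parcs H)\<^sup>+"
  then obtain p where "awalk x p x" "p \<noteq> []" using reachable1_awalk by auto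
  then have "closed_w p" by (auto simp: closed_w_def)
  then obtain c where "cycle c" using closed_w_imp_cycle by blast
  then obtain u where c: "u \<in> pverts H" "set c \<subseteq> parcs H" "pcas u c u"
      "distinct (tl (pawalk_verts u c))" "c \<noteq> []"
    by (auto simp: cycle_with_proj_iff)
  then have "pre_digraph.cycle (with_proj (mk_symmetric (with_proj H))) c"
    by (auto simp: cycle_with_proj_iff parcs_mk_symmetric_with_proj)
  then have "length c < 3" using assms(2) by (auto simp: underlying_forest_def)
  moreover have "length c \<noteq> 1"
  proof
    assume "length c = 1"
    then obtain e where "c = [e]" by (auto simp: length_Suc_conv)
    then show False using c pair_no_loops[of e] by auto
  qed
  moreover have "length c \<noteq> 2"
  proof
    assume "length c = 2"
    then obtain e f where "c = [e, f]" by (auto simp: length_Suc_conv numeral_2_eq_2)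
    then show False using c assms(2) by (cases e; cases f) (auto simp: underlying_forest_def)
  qed
  moreover have "length c \<noteq> 0" using c by simp
  ultimately show False by linarith
qed

section \<open>Weak components and roots\<close>

definition weak_component_at :: "'v rel \<Rightarrow> 'v \<Rightarrow> 'v pair_pre_digraph" where
  "weak_component_at E x =
    \<lparr>pverts = {y. (x, y) \<in> (E \<union> E\<inverse>)\<^sup>*},
     parcs = E \<inter> {y. (x, y) \<in> (E \<union> E\<inverse>)\<^sup>*} \<times> {y. (x, y) \<in> (E \<union> E\<inverse>)\<^sup>*}\<rparr>"

definition tree_at :: "'v rel \<Rightarrow> 'v \<Rightarrow> 'v pair_pre_digraph" where
  "tree_at E s =
    \<lparr>pverts = {x. (x, s) \<in> E\<^sup>*}, parcs = E \<inter> {x. (x, s) \<in> E\<^sup>*} \<times> {x. (x, s) \<in> E\<^sup>*}\<rparr>"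

lemma rtrancl_on_UNIV: "rtrancl_on UNIV r = r\<^sup>*"
proof (intro set_eqI iffI; clarify)
  fix a b
  show "(a, b) \<in> r\<^sup>*" if "(a, b) \<in> rtrancl_on UNIV r"
    using that by induction auto
  show "(a, b) \<in> rtrancl_on UNIV r" if "(a, b) \<in> r\<^sup>*"
    using that by induction (auto intro: rtrancl_on_into_rtrancl_on)
qed

text \<open>
  In a symmetric digraph reachability is an equivalence relation, so the strong components are its
  classes.
\<close>

lemma weak_components_eq:
  "weak_components \<lparr>pverts = UNIV, parcs = E\<rparr> = range (weak_component_at E)"
proof -
  let ?H = "\<lparr>pverts = UNIV, parcs = E\<rparr>"
  interpret pair_wf_digraph "mk_symmetric (with_proj ?H)" by unfold_locales auto
  have reach: "reachable (with_proj (mk_symmetric (with_proj ?H))) x y \<longleftrightarrow> (x, y) \<in> (E \<union> E\<inverse>)\<^sup>*" for x y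
    by (simp add: reachable_def rtrancl_on_UNIV parcs_mk_symmetric_with_proj)
  have "sym ((E \<union> E\<inverse>)\<^sup>*)" by (intro sym_rtrancl sym_Un_converse)
  then have "scc_of x = {y. (x, y) \<in> (E \<union> E\<inverse>)\<^sup>*}" for x
    by (auto simp: scc_of_def reach dest: symD)
  then show ?thesis
    unfolding weak_components_def sccs_verts_conv_scc_of
    by (auto simp: weak_component_at_def Let_def image_iff)
qed

text \<open>
  The set of vertices that reach \<open>s\<close> is closed under traversing arcs in either direction:
  forwards because each vertex has only one out-arc, backwards trivially.
\<close>

lemma branching_weak_component:
  fixes E :: "'v::finite rel"
  assumes E: "branching E" and s: "s \<notin> Domain E" and xs: "(x, s) \<in> E\<^sup>*"
  shows "weak_component_at E x = tree_at E s"
proof -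
  have sv: "single_valued E" using E by (simp add: branching_def)
  have "(y, s) \<in> E\<^sup>*" if "(x, y) \<in> (E \<union> E\<inverse>)\<^sup>*" for y
    using that
  proof induction
    case (step y z)
    show ?case
    proof (cases "(y, z) \<in> E")
      case True
      then have "y \<noteq> s" using s by auto
      then obtain w where "(y, w) \<in> E" "(w, s) \<in> E\<^sup>*" using step.IH by (auto elim: converse_rtranclE)
      then show ?thesis using True sv by (auto simp: single_valued_def)
    next
      case False
      then have "(z, y) \<in> E" using step by auto
      then show ?thesis using step.IH by (rule converse_rtrancl_into_rtrancl)
    qed
  qed (rule xs)
  moreover have "(x, y) \<in> (E \<union> E\<inverse>)\<^sup>*" if "(y, s) \<in> E\<^sup>*" for y
  proof -
    have "(s, y) \<in> (E\<inverse>)\<^sup>*" using that by (simp add: rtrancl_converse)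
    then show ?thesis using xs
      by (meson rtrancl_trans in_rtrancl_UnI)
  qed
  ultimately have "{y. (x, y) \<in> (E \<union> E\<inverse>)\<^sup>*} = {y. (y, s) \<in> E\<^sup>*}" by auto
  then show ?thesis by (simp add: weak_component_at_def tree_at_def)
qed

lemma branching_weak_components:
  fixes E :: "'v::finite rel"
  assumes E: "branching E"
  shows "weak_components \<lparr>pverts = UNIV, parcs = E\<rparr> = tree_at E ` (- Domain E)"
  unfolding weak_components_eq
proof (intro equalityI subsetI; clarify)
  fix x
  obtain s where "(x, s) \<in> E\<^sup>*" "s \<notin> Domain E" using branching_reaches_root[OF E] by blast
  then show "weak_component_at E x \<in> tree_at E ` (- Domain E)"
    using branching_weak_component[OF E] by blast
next
  fix s assume "s \<notin> Domain E"
  then show "tree_at E s \<in> range (weak_component_at E)"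
    using branching_weak_component[OF E, of s s] by (metis rangeI rtrancl.rtrancl_refl)
qed

lemma branching_is_root_iff:
  fixes E :: "'v::finite rel"
  assumes E: "branching E" and s: "s \<notin> Domain E"
  shows "is_root (tree_at E s) r \<longleftrightarrow> r = s"
proof
  have sv: "single_valued E" and ac: "acyclic E" using E by (simp_all add: branching_def)
  show "r = s" if r: "is_root (tree_at E s) r"
  proof -
    have "s \<in> pverts (tree_at E s)" by (simp add: tree_at_def)
    then obtain p where "pre_digraph.apath (with_proj (tree_at E s)) s p r"
      using r unfolding is_root_def by blast
    then have "pcas s p r" "set p \<subseteq> parcs (tree_at E s)" by (auto simp: apath_with_proj_iff)
    then show ?thesis using s by (cases p) (auto simp: tree_at_def)
  qed
  have path: "\<exists>p. pre_digraph.apath (with_proj (tree_at E s)) u p s" if "(u, s) \<in> E\<^sup>*" for u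
    using that
  proof (induction rule: converse_rtrancl_induct)
    case base
    show ?case by (rule exI[of _ "[]"]) (simp add: apath_with_proj_iff tree_at_def)
  next
    case (step u w)
    then obtain p where p: "set p \<subseteq> parcs (tree_at E s)" "pcas w p s" "distinct (pawalk_verts w p)"
      by (auto simp: apath_with_proj_iff)
    have "set p \<subseteq> E" using p(1) by (auto simp: tree_at_def)
    then have "u \<notin> set (pawalk_verts w p)"
      using pawalk_verts_reach[OF p(2)] ac step.hyps(1)
      by (meson acyclic_def rtrancl_into_trancl2)
    moreover have "(u, s) \<in> E\<^sup>*" using step.hyps by (rule converse_rtrancl_into_rtrancl)
    ultimately show ?case using p step.hyps
      by (intro exI[of _ "(u, w) # p"]) (auto simp: apath_with_proj_iff tree_at_def)
  qed
  have "p = q" if "pre_digraph.apath (with_proj (tree_at E s)) u p s"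
    "pre_digraph.apath (with_proj (tree_at E s)) u q s" for u p q
    using that by (intro pcas_unique[OF sv s]) (auto simp: apath_with_proj_iff tree_at_def)
  then have "is_root (tree_at E s) s"
    unfolding is_root_def using path by (auto simp: tree_at_def)
  then show "is_root (tree_at E s) r" if "r = s" using that by simp
qed

lemma root_of_tree_at:
  fixes E :: "'v::finite rel"
  assumes "branching E" "s \<notin> Domain E"
  shows "root_of (tree_at E s) = s"
  unfolding root_of_def by (intro the_equality) (simp_all add: branching_is_root_iff[OF assms])

text \<open>
  Two out-arcs of \<open>x\<close>, prolonged by paths from their heads to the root, would give two paths from \<open>x\<close> to
  the root; by acyclicity these paths do not revisit \<open>x\<close>.
\<close>

lemma rooted_forest_single_valued:
  fixes H :: "'v::finite pair_pre_digraph"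
  assumes H: "rooted_forest k H" and V: "pverts H = UNIV"
  shows "single_valued (parcs H)"
proof (rule single_valuedI)
  let ?E = "parcs H"
  fix x y z assume xy: "(x, y) \<in> ?E" and xz: "(x, z) \<in> ?E"
  have ac: "acyclic ?E" using H underlying_forest_acyclic by (auto simp: rooted_forest_def)
  define T where "T = weak_component_at ?E x"
  have "H = \<lparr>pverts = UNIV, parcs = ?E\<rparr>" using V by simp
  then have "T \<in> weak_components H" using weak_components_eq[of ?E] by (auto simp: T_def)
  then obtain r where r: "is_root T r" using H by (auto simp: rooted_forest_def)
  have T: "x \<in> pverts T" "y \<in> pverts T" "z \<in> pverts T" "(x, y) \<in> parcs T" "(x, z) \<in> parcs T" "parcs T \<subseteq> ?E"
    using xy xz by (auto simp: T_def weak_component_at_def)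
  have ext: "\<exists>p. pre_digraph.apath (with_proj T) x ((x, w) # p) r"
    if w: "w \<in> pverts T" "(x, w) \<in> parcs T" for w
  proof -
    obtain p where p: "set p \<subseteq> parcs T" "pcas w p r" "distinct (pawalk_verts w p)"
      using r w by (auto simp: is_root_def apath_with_proj_iff)
    have "set p \<subseteq> ?E" using p(1) T by auto
    then have "x \<notin> set (pawalk_verts w p)"
      using pawalk_verts_reach[OF p(2)] ac w T
      by (meson acyclic_def rtrancl_into_trancl2 subsetD)
    then show ?thesis using p w T by (auto simp: apath_with_proj_iff)
  qed
  show "y = z"
    using ext[of y] ext[of z] T r unfolding is_root_def by (metis list.inject prod.inject)
qed

text \<open>
  The translation from digraphs to arc sets. The number of components is the number of roots, since
  the tree of a root determines that root.
\<close>

theorem spanning_rooted_forests_eq: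
  fixes G :: "'v::finite pair_pre_digraph"
  assumes G: "pair_digraph G" and V: "pverts G = UNIV"
  shows "spanning_rooted_forests G k = (\<lambda>E. \<lparr>pverts = UNIV, parcs = E\<rparr>) `
    {E. E \<subseteq> parcs G \<and> branching E \<and> card (- Domain E) = k}" (is "_ = ?mk ` _")
proof -
  have card: "card (weak_components (?mk E)) = card (- Domain E)" if "branching E" for E :: "'v rel"
    unfolding branching_weak_components[OF that]
    by (intro card_image inj_onI) (metis ComplD root_of_tree_at that)
  show ?thesis
  proof (intro equalityI subsetI)
    fix H assume "H \<in> spanning_rooted_forests G k"
    then have sp: "spanning (with_proj H) (with_proj G)" and H: "rooted_forest k H"
      by (auto simp: spanning_rooted_forests_def)
    have VH: "pverts H = UNIV" and sub: "parcs H \<subseteq> parcs G"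
      using sp V by (auto simp: spanning_def subgraph_def)
    have E: "branching (parcs H)"
      using H underlying_forest_acyclic rooted_forest_single_valued[OF H VH]
      by (auto simp: branching_def rooted_forest_def)
    have eq: "H = ?mk (parcs H)" using VH by simp
    have "card (- Domain (parcs H)) = k"
      using card[OF E] H by (simp add: rooted_forest_def eq[symmetric])
    then show "H \<in> ?mk ` {E. E \<subseteq> parcs G \<and> branching E \<and> card (- Domain E) = k}"
      using eq E sub by blast
  next
    fix H assume "H \<in> ?mk ` {E. E \<subseteq> parcs G \<and> branching E \<and> card (- Domain E) = k}"
    then obtain E where H: "H = ?mk E" and E: "E \<subseteq> parcs G" "branching E" "card (- Domain E) = k"
      by auto
    interpret G: pair_digraph G by fact
    interpret H: pair_digraph H
      using E(1) G.pair_no_loops by unfold_locales (auto simp: H)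
    have "spanning (with_proj H) (with_proj G)"
      unfolding spanning_def subgraph_def compatible_def
      using V E(1) H.wf_digraph_axioms G.wf_digraph_axioms by (auto simp: H)
    moreover have "rooted_forest k H"
      unfolding rooted_forest_def
      using H.pair_digraph_axioms branching_underlying_forest[OF E(2)] card[OF E(2)] E(3)
        branching_is_root_iff[OF E(2)]
      by (auto simp: H branching_weak_components[OF E(2)])
    ultimately show "H \<in> spanning_rooted_forests G k" by (simp add: spanning_rooted_forests_def)
  qed
qed

section \<open>Sums over rooted forests as sums over branchings\<close>

lemma sum_subset_branchings:
  fixes f :: "'v::finite rel \<Rightarrow> real"
  assumes supp: "{e. \<omega> e \<noteq> 0} \<subseteq> A"
  shows "(\<Sum>E | E \<in> branchings S \<and> E \<subseteq> A. f E * arcs_weight \<omega> E) =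
    (\<Sum>E\<in>branchings S. f E * arcs_weight \<omega> E)"
proof (intro sum.mono_neutral_left ballI)
  fix E assume "E \<in> branchings S - {E. E \<in> branchings S \<and> E \<subseteq> A}"
  then obtain e where "e \<in> E" "\<omega> e = 0" using supp by blast
  then show "f E * arcs_weight \<omega> E = 0" by (auto simp: arcs_weight_def)
qed auto

lemma tree_weight_eq_branching_total:
  fixes G :: "'v::finite pair_pre_digraph"
  assumes G: "pair_digraph G" and V: "pverts G = UNIV" and supp: "{e. \<omega> e \<noteq> 0} \<subseteq> parcs G"
  shows "tree_weight G \<omega> w = branching_total \<omega> w"
proof -
  let ?mk = "\<lambda>E. \<lparr>pverts = UNIV, parcs = E\<rparr>"
  have root: "root_of (?mk E) = s" if E: "branching E" "- Domain E = {s}" for E :: "'v rel" and s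
  proof -
    have "tree_at E s = ?mk E"
    proof -
      have "(x, s) \<in> E\<^sup>*" for x using branching_reaches_root[OF E(1), of x] E(2)
        by (metis ComplI singletonD)
      then show ?thesis by (simp add: tree_at_def)
    qed
    moreover have "s \<notin> Domain E" using E(2) by auto
    ultimately show ?thesis using root_of_tree_at[OF E(1)] by metis
  qed
  have "{T \<in> spanning_rooted_forests G 1. root_of T = w} =
      ?mk ` {E. E \<in> branchings {w} \<and> E \<subseteq> parcs G}"
  proof (intro equalityI subsetI)
    fix T assume "T \<in> {T \<in> spanning_rooted_forests G 1. root_of T = w}"
    then obtain E where T: "T = ?mk E" "root_of T = w"
      and E: "E \<subseteq> parcs G" "branching E" "card (- Domain E) = 1"
      unfolding spanning_rooted_forests_eq[OF G V] by auto
    obtain s where s: "- Domain E = {s}" using E(3) by (auto simp: card_1_singleton_iff)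
    then have "s = w" using root[OF E(2) s] T by simp
    then have "Domain E = - {w}" using s by auto
    then show "T \<in> ?mk ` {E. E \<in> branchings {w} \<and> E \<subseteq> parcs G}"
      using T E by (auto simp: branchings_def)
  next
    fix T assume "T \<in> ?mk ` {E. E \<in> branchings {w} \<and> E \<subseteq> parcs G}"
    then obtain E where T: "T = ?mk E" and E: "branching E" "- Domain E = {w}" "E \<subseteq> parcs G"
      by (auto simp: branchings_def)
    then show "T \<in> {T \<in> spanning_rooted_forests G 1. root_of T = w}"
      unfolding spanning_rooted_forests_eq[OF G V] using root[OF E(1,2)] by auto
  qed
  then have "tree_weight G \<omega> w = (\<Sum>E | E \<in> branchings {w} \<and> E \<subseteq> parcs G. arcs_weight \<omega> E)"
    unfolding tree_weight_def
    by (simp add: sum.reindex inj_on_def forest_weight_def arcs_weight_def)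
  then show ?thesis
    using sum_subset_branchings[where f = "\<lambda>_. 1" and S = "{w}", OF supp] by (simp add: branching_total_def)
qed

text \<open>
  A 2-forest with a naming of its components such that the first has root \<open>v\<close> is the same as a branching
  with roots \<open>v\<close> and some \<open>r \<noteq> v\<close>.
\<close>

lemma sum_named_two_forests:
  fixes G :: "'v::finite pair_pre_digraph" and f :: "'v pair_pre_digraph \<Rightarrow> 'v pair_pre_digraph \<Rightarrow> real"
  assumes G: "pair_digraph G" and V: "pverts G = UNIV" and supp: "{e. \<omega> e \<noteq> 0} \<subseteq> parcs G"
  shows "(\<Sum>(F, T1, T2)\<in>{(F, T1, T2) \<in> named_two_forests G. P T1 T2 \<and> root_of T1 = v}.
      f T1 T2 * forest_weight \<omega> F) =
    (\<Sum>r\<in>- {v}. \<Sum>E\<in>branchings {r, v}.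
      of_bool (P (tree_at E v) (tree_at E r)) * f (tree_at E v) (tree_at E r) * arcs_weight \<omega> E)"
    (is "sum ?g ?A = _")
proof -
  let ?mk = "\<lambda>E. \<lparr>pverts = UNIV, parcs = E\<rparr>"
  let ?B = "SIGMA r:- {v}. {E. E \<in> branchings {r, v} \<and> E \<subseteq> parcs G}"
  let ?Q = "\<lambda>(r, E). P (tree_at E v) (tree_at E r)"
  let ?h = "\<lambda>(r, E). (?mk E, tree_at E v, tree_at E r)"
  have root: "root_of (tree_at E s) = s" if "E \<in> branchings S" "s \<in> S" for E :: "'v rel" and s S
    using that by (intro root_of_tree_at) (auto simp: branchings_def)
  have A: "?A = ?h ` {b \<in> ?B. ?Q b}"
  proof (intro equalityI subsetI)
    fix a assume "a \<in> ?A"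
    then obtain E T1 T2 where a: "a = (?mk E, T1, T2)" "P T1 T2" "root_of T1 = v"
      and E: "E \<subseteq> parcs G" "branching E" "card (- Domain E) = 2"
      and T: "weak_components (?mk E) = {T1, T2}"
      unfolding named_two_forests_def spanning_rooted_forests_eq[OF G V] by auto
    obtain s t where st: "- Domain E = {s, t}" "s \<noteq> t" using E(3) by (auto simp: card_2_iff)
    then have Es: "E \<in> branchings {s, t}" using E by (auto simp: branchings_def)
    have "{T1, T2} = {tree_at E s, tree_at E t}"
      using T st by (simp add: branching_weak_components[OF E(2)])
    moreover have "tree_at E s \<noteq> tree_at E t" using root[OF Es] st(2) by (metis insertCI)
    ultimately have "(T1 = tree_at E s \<and> T2 = tree_at E t) \<or> (T1 = tree_at E t \<and> T2 = tree_at E s)"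
      by (metis doubleton_eq_iff)
    then obtain r where r: "r \<noteq> v" "E \<in> branchings {r, v}" "T1 = tree_at E v" "T2 = tree_at E r"
      using a(3) root[OF Es] st(2) Es by (metis insertCI insert_commute)
    then show "a \<in> ?h ` {b \<in> ?B. ?Q b}" using a E by force
  next
    fix a assume "a \<in> ?h ` {b \<in> ?B. ?Q b}"
    then obtain r E where a: "a = (?mk E, tree_at E v, tree_at E r)" "P (tree_at E v) (tree_at E r)"
      and E: "r \<noteq> v" "E \<in> branchings {r, v}" "E \<subseteq> parcs G" by auto
    have b: "branching E" and D: "- Domain E = {r, v}" using E by (auto simp: branchings_def)
    have "weak_components (?mk E) = {tree_at E v, tree_at E r}"
      by (auto simp: branching_weak_components[OF b] D)
    moreover have "?mk E \<in> spanning_rooted_forests G 2"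
      unfolding spanning_rooted_forests_eq[OF G V] using b D E by auto
    ultimately show "a \<in> ?A" using a root[OF E(2)] by (auto simp: named_two_forests_def)
  qed
  have inj: "inj_on ?h {b \<in> ?B. ?Q b}"
  proof (rule inj_onI)
    fix a b assume ab: "a \<in> {b \<in> ?B. ?Q b}" "b \<in> {b \<in> ?B. ?Q b}" "?h a = ?h b"
    obtain r E r' E' where eqs: "a = (r, E)" "b = (r', E')" by fastforce
    then have "E' = E" "E \<in> branchings {r, v}" "E \<in> branchings {r', v}" "tree_at E r = tree_at E r'"
      using ab by auto
    then show "a = b" using root eqs by (metis insertI1)
  qed
  have "sum ?g ?A = (\<Sum>(r, E)\<in>{b \<in> ?B. ?Q b}. f (tree_at E v) (tree_at E r) * arcs_weight \<omega> E)"
    unfolding A sum.reindex[OF inj] by (intro sum.cong) (auto simp: forest_weight_def arcs_weight_def)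
  also have "\<dots> = (\<Sum>(r, E)\<in>?B. of_bool (P (tree_at E v) (tree_at E r)) *
      f (tree_at E v) (tree_at E r) * arcs_weight \<omega> E)"
    by (rule sum.mono_neutral_cong_left) auto
  also have "\<dots> = (\<Sum>r\<in>- {v}. \<Sum>E | E \<in> branchings {r, v} \<and> E \<subseteq> parcs G.
      of_bool (P (tree_at E v) (tree_at E r)) * f (tree_at E v) (tree_at E r) * arcs_weight \<omega> E)"
    by (subst sum.Sigma) auto
  also have "\<dots> = (\<Sum>r\<in>- {v}. \<Sum>E\<in>branchings {r, v}.
      of_bool (P (tree_at E v) (tree_at E r)) * f (tree_at E v) (tree_at E r) * arcs_weight \<omega> E)"
    by (intro sum.cong refl sum_subset_branchings[OF supp])
  finally show ?thesis .
qed

section \<open>The forest formula for the normalized Green's function\<close>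

theorem theorem1p4:
  fixes G :: "'v::finite pair_pre_digraph" and \<omega> :: "('v \<times> 'v) weight_fun" and u v :: 'v
  assumes "weighted_digraph G \<omega>" and "strongly_connected (with_proj G)"
  shows "normalized_green \<omega> $ u $ v =
    sqrt (stationary \<omega> $ u * stationary \<omega> $ v) / tree_weight G \<omega> v *
    ((\<Sum>(F, T1, T2)\<in>{(F, T1, T2) \<in> named_two_forests G. u \<in> pverts T1 \<and> root_of T1 = v}.
        stationary_mass \<omega> T2 * weighted_degree \<omega> (root_of T2) * forest_weight \<omega> F)
   - (\<Sum>(F, T1, T2)\<in>{(F, T1, T2) \<in> named_two_forests G. u \<in> pverts T2 \<and> root_of T1 = v}.
        stationary_mass \<omega> T1 * weighted_degree \<omega> (root_of T2) * forest_weight \<omega> F))"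
proof -
  interpret weighted_digraph G \<omega> by fact
  have G: "pair_digraph G" by unfold_locales
  have supp: "{e. \<omega> e \<noteq> 0} \<subseteq> parcs G" using weight_zero by blast
  have nonneg: "\<omega> e \<ge> 0" for e using weight_pos[of e] weight_zero[of e] by (cases "e \<in> parcs G") auto
  have support: "{e. \<omega> e > 0} = parcs G" using weight_pos weight_zero by (auto, metis less_irrefl)
  have reach: "(x, y) \<in> {e. \<omega> e > 0}\<^sup>*" for x y
    using assms(2) verts_UNIV support by (auto simp: strongly_connected_def reachable_def rtrancl_on_UNIV)
  have tau: "branching_total \<omega> w > 0" for w
    using nonneg reach by (rule branching_total_pos)
  have deg: "weighted_degree \<omega> w > 0" for w
  proof -
    have "(UNIV :: 'v set) \<noteq> {w}"
    proof
      assume "(UNIV :: 'v set) = {w}"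
      from arg_cong[OF this, of card] have "card (UNIV :: 'v set) = 1" by simp
      then show False using at_least_two_verts by (simp add: verts_UNIV)
    qed
    then obtain z where "z \<noteq> w" by auto
    then obtain y where "\<omega> (w, y) > 0" using reach[of w z] by (auto elim: converse_rtranclE)
    then show ?thesis unfolding weighted_degree_def using nonneg by (intro sum_pos2[of _ y]) auto
  qed
  note sums = sum_named_two_forests[OF G verts_UNIV supp, where v = v]
  let ?S1 = "\<Sum>(F, T1, T2)\<in>{(F, T1, T2) \<in> named_two_forests G. u \<in> pverts T1 \<and> root_of T1 = v}.
        stationary_mass \<omega> T2 * weighted_degree \<omega> (root_of T2) * forest_weight \<omega> F"
  let ?S2 = "\<Sum>(F, T1, T2)\<in>{(F, T1, T2) \<in> named_two_forests G. u \<in> pverts T2 \<and> root_of T1 = v}.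
        stationary_mass \<omega> T1 * weighted_degree \<omega> (root_of T2) * forest_weight \<omega> F"
  have "?S1 - ?S2 = green_sum \<omega> u v"
    unfolding green_sum_def
      sums[where P = "\<lambda>T1 T2. u \<in> pverts T1"
        and f = "\<lambda>T1 T2. stationary_mass \<omega> T2 * weighted_degree \<omega> (root_of T2)"]
      sums[where P = "\<lambda>T1 T2. u \<in> pverts T2"
        and f = "\<lambda>T1 T2. stationary_mass \<omega> T1 * weighted_degree \<omega> (root_of T2)"]
      sum_subtractf[symmetric]
  proof (intro sum.cong refl)
    fix r E assume "r \<in> - {v}" and E: "E \<in> branchings {r, v}"
    have "root_of (tree_at E r) = r" using E by (intro root_of_tree_at) (auto simp: branchings_def)
    then show "of_bool (u \<in> pverts (tree_at E v)) * (stationary_mass \<omega> (tree_at E r) *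
          weighted_degree \<omega> (root_of (tree_at E r))) * arcs_weight \<omega> E -
        of_bool (u \<in> pverts (tree_at E r)) * (stationary_mass \<omega> (tree_at E v) *
          weighted_degree \<omega> (root_of (tree_at E r))) * arcs_weight \<omega> E =
        weighted_degree \<omega> r * arcs_weight \<omega> E *
          (of_bool ((u, v) \<in> E\<^sup>*) * (\<Sum>z | (z, r) \<in> E\<^sup>*. stationary \<omega> $ z) -
           of_bool ((u, r) \<in> E\<^sup>*) * (\<Sum>z | (z, v) \<in> E\<^sup>*. stationary \<omega> $ z))"
      by (simp add: stationary_mass_def tree_at_def algebra_simps)
  qed
  then show ?thesis
    unfolding normalized_green_green_sum[OF deg tau] tree_weight_eq_branching_total[OF G verts_UNIV supp]
    by simp
qed

end
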